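(* Let $n\ge 3$ and let $R>1$ be fixed. Let $R_\ast>1$ and let $\rho$ be a regular metric on $A(1,R_\ast)$, i.e. $\rho(y)=\rho(|y|)$ is given by a positive $C^1$ function $\rho$ on $[1,R_\ast]$ with $$\min_{1\le s\le R_\ast}\rho(s)s^n=\rho(1).$$ Put $c_\diamond=\rho(1)$. Then there is a radial $(\rho,n)$-harmonic diffeomorphism $h=h_c$ between the annuli $A(1,R)$ and $A(1,R_\ast)$ if and only if $$H_{c_\diamond}(R)\le R_\ast ,$$ or, equivalently, if and only if $$c(R,R_\ast)\le \rho(1).$$
   Context: $A(1,R)=\{x\in\mathbb R^n: 1<|x|<R\}$. **Radial $(\rho,n)$-harmonic diffeomorphism.** The energy is $\mathscr E_\rho[h]=\int_{A(1,R)}\rho(|h(x)|)\,\|Dh(x)\|^n\,dx$, where $\|\cdot\|$ is the Hilbert–Schmidt norm. A radial $(\rho,n)$-harmonic diffeomorphism of $A(1,R)$ onto $A(1,R_\ast)$ is a map $h(x)=H(|x|)\frac{x}{|x|}$, where $H$ is an increasing $C^2$ diffeomorphism of $(1,R)$ onto $(1,R_\ast)$ and $h$ satisfies the (inner variation) equation $$\operatorname{Div}\Big(\rho(|h|)\|Dh\|^{n-2}D^*h\,Dh-\tfrac{\rho(|h|)}{n}\|Dh\|^nI\Big)=0\quad\text{in }A(1,R).$$ For such $H$ this is equivalent to the existence of a constant $c$ with $$\rho(H(t))\big(H(t)^2-t^2\dot H(t)^2\big)\Big(H(t)^2+\tfrac{t^2\dot H(t)^2}{n-1}\Big)^{\frac{n-2}{2}}\equiv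 c .$$ **The functions $T_c$, $H_c$, $h_c$.** Let $\Phi(\zeta)=(1-\zeta)\big(1+\frac{\zeta}{n-1}\big)^{(n-2)/2}$. It is a strictly decreasing bijection $[0,\infty)\to(-\infty,1]$; let $\Psi=\Phi^{-1}$. For $c\le\rho(1)$ put $v_c(y)=\frac{c}{y^n\rho(y)}\ (\le 1)$ and $$T_c(s)=\exp\Big[\int_1^s\frac{dy}{y\sqrt{\Psi(v_c(y))}}\Big]\in[1,\infty],\qquad s\in[1,R_\ast].$$ Where $T_c$ is finite, $H_c=T_c^{-1}$ is its inverse, and $h_c(x)=H_c(|x|)\frac{x}{|x|}$. **Meaning of the conditions.** $H_{c_\diamond}(R)\le R_\ast$ means $R\le T_{c_\diamond}(R_\ast)$ (the value $+\infty$ is allowed for $T_{c_\diamond}(R_\ast)$). The number $c(R,R_\ast)$ is the $c$ determined by $T_c(R_\ast)=R$; the condition $c(R,R_\ast)\le\rho(1)$ means that there exists $c\in(-\infty,\rho(1)]$ with $T_c(R_\ast)=R$.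
   Formalization: If R equals T_c(R_* ) at c=ρ(1) and ρ(s)s^n=ρ(1) for some s in (1,R_* ), the C² diffeomorphism criterion is false since H' vanishes at an interior point; there it is stated only for increasing C² homeomorphisms H. *)

theory Defs
  imports "HOL-Analysis.Analysis"
begin

definition annulus :: "real \<Rightarrow> real \<Rightarrow> ('a::real_normed_vector) set" where
  "annulus r s = {x. r < norm x \<and> norm x < s}"

(* One-sided derivatives at the end points. The infimum below is taken over a compact interval,
   so it is a minimum. *)
definition regular_metric :: "nat \<Rightarrow> real \<Rightarrow> (real \<Rightarrow> real) \<Rightarrow> bool" where
  "regular_metric n Rs \<rho> \<longleftrightarrow>
     (\<forall>s\<in>{1..Rs}. 0 < \<rho> s) \<and>
     (\<exists>\<rho>'. continuous_on {1..Rs} \<rho>' \<and>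
        (\<forall>s\<in>{1..Rs}. (\<rho> has_real_derivative \<rho>' s) (at s within {1..Rs}))) \<and>
     (INF s\<in>{1..Rs}. \<rho> s * s ^ n) = \<rho> 1"

definition C2_on :: "real set \<Rightarrow> (real \<Rightarrow> real) \<Rightarrow> bool" where
  "C2_on S f \<longleftrightarrow> (\<exists>f' f''.
     (\<forall>t\<in>S. (f has_real_derivative f' t) (at t) \<and> (f' has_real_derivative f'' t) (at t)) \<and>
     continuous_on S f'')"

definition increasing_C2_homeo :: "real \<Rightarrow> real \<Rightarrow> (real \<Rightarrow> real) \<Rightarrow> bool" where
  "increasing_C2_homeo R Rs H \<longleftrightarrow>
     strict_mono_on {1<..<R} H \<and> bij_betw H {1<..<R} {1<..<Rs} \<and> C2_on {1<..<R} H"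

definition increasing_C2_diffeo :: "real \<Rightarrow> real \<Rightarrow> (real \<Rightarrow> real) \<Rightarrow> bool" where
  "increasing_C2_diffeo R Rs H \<longleftrightarrow>
     increasing_C2_homeo R Rs H \<and> C2_on {1<..<Rs} (the_inv_into {1<..<R} H)"

definition radial_map :: "(real \<Rightarrow> real) \<Rightarrow> real^'n \<Rightarrow> real^'n" where
  "radial_map H x = H (norm x) *\<^sub>R (x /\<^sub>R norm x)"

definition Jacobi_matrix :: "(real^'n \<Rightarrow> real^'n) \<Rightarrow> real^'n \<Rightarrow> real^'n^'n" where
  "Jacobi_matrix h x = matrix (frechet_derivative h (at x))"

(* The library norm on real^'n^'n is the Hilbert--Schmidt norm. *)
definition stress :: "(real \<Rightarrow> real) \<Rightarrow> (real^'n \<Rightarrow> real^'n) \<Rightarrow> real^'n \<Rightarrow> real^'n^'n" where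
  "stress \<rho> h x =
     (let D = Jacobi_matrix h x; n = CARD('n) in
        (\<rho> (norm (h x)) * norm D ^ (n - 2)) *\<^sub>R (transpose D ** D)
        - (\<rho> (norm (h x)) / real n * norm D ^ n) *\<^sub>R mat 1)"

(* Row-wise divergence; the matrix fields it is applied to are symmetric. *)
definition Div :: "(real^'n \<Rightarrow> real^'n^'n) \<Rightarrow> real^'n \<Rightarrow> real^'n" where
  "Div M x = (\<chi> i. \<Sum>j\<in>UNIV. frechet_derivative M (at x) (axis j 1) $ i $ j)"

definition inner_variation_eq :: "(real \<Rightarrow> real) \<Rightarrow> real \<Rightarrow> (real^'n \<Rightarrow> real^'n) \<Rightarrow> bool" where
  "inner_variation_eq \<rho> R h \<longleftrightarrow>
     (\<forall>x\<in>annulus 1 R. stress \<rho> h differentiable (at x) \<and> Div (stress \<rho> h) x = 0)"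

definition radial_harmonic_diffeo ::
    "(real \<Rightarrow> real) \<Rightarrow> real \<Rightarrow> real \<Rightarrow> (real^'n \<Rightarrow> real^'n) \<Rightarrow> bool" where
  "radial_harmonic_diffeo \<rho> R Rs h \<longleftrightarrow>
     (\<exists>H. increasing_C2_diffeo R Rs H \<and> (\<forall>x\<in>annulus 1 R. h x = radial_map H x)) \<and>
     inner_variation_eq \<rho> R h"

(* As above, but H' may vanish, i.e. the inverse of H need not be differentiable. This happens
   for the critical map (c = \<rho>(1)) when \<rho>(s) s^n attains its minimum \<rho>(1) also at an interior point
   and T_c is nevertheless finite, e.g. \<rho>(s) s^n = 1 + (s - 1) |s - s0|^(3/2). *)
definition radial_harmonic_homeo ::
    "(real \<Rightarrow> real) \<Rightarrow> real \<Rightarrow> real \<Rightarrow> (real^'n \<Rightarrow> real^'n) \<Rightarrow> bool" where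
  "radial_harmonic_homeo \<rho> R Rs h \<longleftrightarrow>
     (\<exists>H. increasing_C2_homeo R Rs H \<and> (\<forall>x\<in>annulus 1 R. h x = radial_map H x)) \<and>
     inner_variation_eq \<rho> R h"

definition Phi :: "nat \<Rightarrow> real \<Rightarrow> real" where
  "Phi n \<zeta> = (1 - \<zeta>) * (1 + \<zeta> / (real n - 1)) powr ((real n - 2) / 2)"

definition Psi :: "nat \<Rightarrow> real \<Rightarrow> real" where
  "Psi n = the_inv_into {0..} (Phi n)"

definition v :: "nat \<Rightarrow> (real \<Rightarrow> real) \<Rightarrow> real \<Rightarrow> real \<Rightarrow> real" where
  "v n \<rho> c y = c / (y ^ n * \<rho> y)"

(* The reciprocal is taken in ennreal, so that the integrand is \<infinity> (and not 0) where Psi (v y) = 0. *)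
definition T :: "nat \<Rightarrow> (real \<Rightarrow> real) \<Rightarrow> real \<Rightarrow> real \<Rightarrow> ereal" where
  "T n \<rho> c s =
     (let I = (\<integral>\<^sup>+y\<in>{1..s}. inverse (ennreal (y * sqrt (Psi n (v n \<rho> c y)))) \<partial>lborel)
      in if I = \<infinity> then \<infinity> else ereal (exp (enn2real I)))"

(* Meaningful for those t that are (finite) values of T_c on [1, Rs]. *)
definition H_inv :: "nat \<Rightarrow> (real \<Rightarrow> real) \<Rightarrow> real \<Rightarrow> real \<Rightarrow> real \<Rightarrow> real" where
  "H_inv n \<rho> Rs c t = the_inv_into {1..Rs} (T n \<rho> c) (ereal t)"

definition h_map :: "(real \<Rightarrow> real) \<Rightarrow> real \<Rightarrow> real \<Rightarrow> real^'n \<Rightarrow> real^'n" where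
  "h_map \<rho> Rs c = radial_map (H_inv CARD('n) \<rho> Rs c)"

end

theory Submission
  imports Defs
begin

text \<open>
  For a radial map the stress tensor is \<open>B(r) (x x\<^sup>T / r\<^sup>2 - I / n)\<close>, whose divergence vanishes iff
  \<open>r\<^sup>n B(r)\<close> is constant. This is the first integral \<open>\<rho>(H) H\<^sup>n \<Phi>((t H' / H)\<^sup>2) = c\<close>, that is, the
  autonomous equation \<open>d H / d (ln t) = g(H)\<close> with \<open>g(y) = y \<surd>\<Psi>(c / (y\<^sup>n \<rho>(y)))\<close>, solved by the inverse
  of \<open>ln T\<^sub>c = \<integral> dy / g(y)\<close>. The positivity of \<open>H'\<close> forces \<open>c \<le> \<rho>(1)\<close>; conversely
  \<open>T\<^sub>c(R\<^sub>*)\<close> increases with \<open>c\<close>, tends to \<open>1\<close> as \<open>c \<rightarrow> -\<infinity>\<close> and, by monotone convergence, to its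
  (possibly infinite) value at the critical parameter \<open>\<rho>(1)\<close> as \<open>c \<rightarrow> \<rho>(1)\<close>, so \<open>R\<close> is attained iff it does not
  exceed that value.

  In the critical case \<open>g\<close> may vanish at interior minima of \<open>y\<^sup>n \<rho>(y)\<close>, possibly on a Cantor set.
  There \<open>H'\<close> vanishes, and \<open>u = \<surd>\<Psi>(c / (H\<^sup>n \<rho>(H)))\<close> is a square root of a function \<open>W\<close> with
  \<open>W' = 2 k \<surd>W\<close> for a continuous \<open>k\<close> vanishing with \<open>W\<close>; this makes \<open>u\<close>, hence \<open>H'\<close>, continuously differentiable.
\<close>

section \<open>The functions \<open>\<Phi>\<close> and \<open>\<Psi>\<close>\<close>

text \<open>The derivative of \<open>Phi n\<close>, factored so that its sign for arguments above -1
  is visible.\<close>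

definition dPhi :: "nat \<Rightarrow> real \<Rightarrow> real" where
  "dPhi n \<zeta> = - (real n / (2 * (real n - 1)) * (1 + \<zeta>) * (1 + \<zeta> / (real n - 1)) powr ((real n - 4) / 2))"

lemma DERIV_Phi:
  assumes "n \<ge> 3" "-1 < \<zeta>"
  shows "(Phi n has_real_derivative dPhi n \<zeta>) (at \<zeta>)"
proof -
  define b where "b = 1 + \<zeta> / (real n - 1)"
  have n1: "real n - 1 > 0" using assms by linarith
  have "- \<zeta> < real n - 1" using assms by linarith
  then have b: "b > 0" using n1 by (simp add: b_def field_simps)
  have e: "(real n - 2) / 2 - 1 = (real n - 4) / 2" by (simp add: field_simps)
  have p: "b powr ((real n - 2) / 2) = b * b powr ((real n - 4) / 2)"
    using b powr_add[of b 1 "(real n - 4) / 2"] by (simp add: field_simps)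
  have "((\<lambda>\<zeta>. 1 + \<zeta> / (real n - 1)) has_real_derivative 1 / (real n - 1)) (at \<zeta>)"
    using n1 by (auto intro!: derivative_eq_intros)
  then have D: "((\<lambda>\<zeta>. (1 + \<zeta> / (real n - 1)) powr ((real n - 2) / 2)) has_real_derivative
      ((real n - 2) / 2) * b powr ((real n - 2) / 2 - 1) * (1 / (real n - 1))) (at \<zeta>)"
    using DERIV_chain2[where f = "\<lambda>z. z powr ((real n - 2) / 2)" and g = "\<lambda>\<zeta>. 1 + \<zeta> / (real n - 1)",
        OF has_real_derivative_powr[OF b[unfolded b_def]]] unfolding b_def by blast
  have "((\<lambda>\<zeta>. (1 - \<zeta>) * (1 + \<zeta> / (real n - 1)) powr ((real n - 2) / 2)) has_real_derivative
      - (b powr ((real n - 2) / 2)) + (1 - \<zeta>) * (((real n - 2) / 2) * b powr ((real n - 2) / 2 - 1) * (1 / (real n - 1)))) (at \<zeta>)"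
    by (rule derivative_eq_intros D refl)+ (simp add: b_def)
  also have "- (b powr ((real n - 2) / 2)) + (1 - \<zeta>) * (((real n - 2) / 2) * b powr ((real n - 2) / 2 - 1) * (1 / (real n - 1)))
      = b powr ((real n - 4) / 2) * (- b + (1 - \<zeta>) * (real n - 2) / 2 / (real n - 1))"
    unfolding e p by (simp only: distrib_left minus_mult_left minus_mult_right mult_ac times_divide_eq_right times_divide_eq_left mult_1_right divide_divide_eq_left)
  also have "- b + (1 - \<zeta>) * (real n - 2) / 2 / (real n - 1) = - (real n / (2 * (real n - 1)) * (1 + \<zeta>))"
    using n1 unfolding b_def by (simp add: divide_simps) (simp add: algebra_simps)
  finally show ?thesis by (simp add: Phi_def[abs_def] dPhi_def b_def mult_ac)
qed

lemma dPhi_neg: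
  assumes "n \<ge> 3" "-1 < \<zeta>" shows "dPhi n \<zeta> < 0"
proof -
  have n1: "real n - 1 > 0" using assms by linarith
  have "- \<zeta> < real n - 1" using assms by linarith
  then have b: "1 + \<zeta> / (real n - 1) > 0" using n1 by (simp add: field_simps)
  show ?thesis using b n1 assms by (simp add: dPhi_def)
qed

lemma continuous_on_dPhi:
  assumes "n \<ge> 3" shows "continuous_on {-1<..} (dPhi n)"
proof -
  have "1 + \<zeta> / (real n - 1) \<noteq> 0" if "-1 < \<zeta>" for \<zeta>
  proof -
    have "- \<zeta> < real n - 1" "real n - 1 > 0" using assms that by linarith+
    then show ?thesis by (simp add: field_simps)
  qed
  moreover have "real n - 1 \<noteq> 0" using assms by linarith
  ultimately show ?thesis unfolding dPhi_def by (intro continuous_intros) auto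
qed

lemma Phi_strict_antimono:
  assumes "n \<ge> 3" "-1 < x" "x < y" shows "Phi n y < Phi n x"
  using DERIV_neg_imp_decreasing[of x y "Phi n"] DERIV_Phi dPhi_neg assms
  by (meson less_le_trans)

lemma Phi_inj_on: "n \<ge> 3 \<Longrightarrow> inj_on (Phi n) {-1<..}"
  by (rule linorder_inj_onI) (auto dest: Phi_strict_antimono)

lemma continuous_on_Phi: "n \<ge> 3 \<Longrightarrow> continuous_on {-1<..} (Phi n)"
  using DERIV_Phi by (meson DERIV_isCont continuous_at_imp_continuous_on greaterThan_iff)

lemma Phi_0 [simp]: "Phi n 0 = 1" by (simp add: Phi_def)

text \<open>Beyond 1 the factor \<open>1 - \<zeta>\<close> is nonpositive and the power is at least
  1. The bound shows that \<open>Phi n\<close> is unbounded below.\<close>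

lemma Phi_le:
  assumes "n \<ge> 3" "1 \<le> \<zeta>" shows "Phi n \<zeta> \<le> 1 - \<zeta>"
proof -
  have "1 \<le> (1 + \<zeta> / (real n - 1)) powr ((real n - 2) / 2)"
    using assms by (intro ge_one_powr_ge_zero) auto
  then have "(1 - \<zeta>) * (1 + \<zeta> / (real n - 1)) powr ((real n - 2) / 2) \<le> (1 - \<zeta>) * 1"
    using assms by (intro mult_left_mono_neg) auto
  then show ?thesis by (simp add: Phi_def)
qed

lemma Phi_surj:
  assumes "n \<ge> 3" "x \<le> 1" obtains \<zeta> where "\<zeta> \<ge> 0" "Phi n \<zeta> = x"
proof -
  \<comment> \<open>As \<open>2 - x\<close> is at least 1, \<open>Phi_le\<close> gives
    \<open>Phi n (2 - x) \<le> x - 1\<close>; with \<open>Phi n 0 = 1\<close> this brackets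
    \<open>x\<close> for the intermediate value theorem.\<close>
  have "Phi n (2 - x) \<le> x" using Phi_le[of n "2 - x"] assms by simp
  moreover have "continuous_on {0..2 - x} (Phi n)"
    by (rule continuous_on_subset[OF continuous_on_Phi]) (use assms in auto)
  ultimately obtain \<zeta> where "0 \<le> \<zeta>" "Phi n \<zeta> = x"
    using IVT2'[of "Phi n" "2 - x" x 0] assms by auto
  then show thesis using that by blast
qed

lemma Psi_Phi:
  assumes "n \<ge> 3" "\<zeta> \<ge> 0" shows "Psi n (Phi n \<zeta>) = \<zeta>"
  unfolding Psi_def using assms
  by (intro the_inv_into_f_f inj_on_subset[OF Phi_inj_on]) auto

lemma Psi_nonneg: "n \<ge> 3 \<Longrightarrow> x \<le> 1 \<Longrightarrow> 0 \<le> Psi n x"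
  by (metis Phi_surj Psi_Phi)

lemma Phi_Psi: "n \<ge> 3 \<Longrightarrow> x \<le> 1 \<Longrightarrow> Phi n (Psi n x) = x"
  by (metis Phi_surj Psi_Phi)

lemma Psi_pos: "n \<ge> 3 \<Longrightarrow> x < 1 \<Longrightarrow> 0 < Psi n x"
  by (metis Phi_0 Phi_Psi Psi_nonneg less_eq_real_def order_less_irrefl)

lemma Psi_antimono:
  assumes "n \<ge> 3" "x \<le> y" "y \<le> 1" shows "Psi n y \<le> Psi n x"
proof (rule ccontr)
  assume "\<not> ?thesis"
  then have "Phi n (Psi n y) < Phi n (Psi n x)"
    using assms Psi_nonneg[of n x] by (intro Phi_strict_antimono) auto
  then show False using assms by (simp add: Phi_Psi)
qed

text \<open>\<open>\<Phi>\<close> stays invertible with non-zero derivative slightly to the left of \<open>0\<close>, so \<open>\<Psi>\<close> extends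
  differentiably beyond the end point \<open>1\<close> of its domain.\<close>

lemma Psi_has_derivative:
  assumes "n \<ge> 3" "x \<le> 1"
  shows "(Psi n has_real_derivative inverse (dPhi n (Psi n x))) (at x within {..1})"
proof -
  let ?g = "the_inv_into {-1<..} (Phi n)"
  have eq: "?g y = Psi n y" if "y \<le> 1" for y
    using the_inv_into_f_f[OF Phi_inj_on[OF assms(1)], of "Psi n y"] Psi_nonneg[OF assms(1) that]
      Phi_Psi[OF assms(1) that] by simp
  have "(?g has_real_derivative inverse (dPhi n (Psi n x))) (at x)"
    unfolding has_field_derivative_def
  proof (rule has_derivative_inverse_strong_x[where S = "{-1<..}" and f = "Phi n"])
    show "(Phi n has_derivative (*) (dPhi n (Psi n x))) (at (?g x))"
      using DERIV_Phi[of n "Psi n x"] Psi_nonneg[OF assms] assms eq by (simp add: has_field_derivative_def)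
    show "(*) (dPhi n (Psi n x)) \<circ> (*) (inverse (dPhi n (Psi n x))) = id"
      using dPhi_neg[of n "Psi n x"] Psi_nonneg[OF assms] assms by (simp add: fun_eq_iff)
    show "continuous_on {-1<..} (Phi n)" using assms continuous_on_Phi by blast
    show "?g x \<in> {-1<..}" using eq assms Psi_nonneg[OF assms] by simp
    show "Phi n (?g x) = x" using eq Phi_Psi assms by simp
    show "?g (Phi n z) = z" if "z \<in> {-1<..}" for z
      using that the_inv_into_f_f[OF Phi_inj_on[OF assms(1)]] by blast
  qed auto
  then have "(?g has_real_derivative inverse (dPhi n (Psi n x))) (at x within {..1})"
    by (rule has_field_derivative_at_within)
  then show ?thesis
    by (rule has_field_derivative_transform_within[where d = 1]) (use assms eq in auto)
qed

lemma continuous_on_Psi: "n \<ge> 3 \<Longrightarrow> continuous_on {..1} (Psi n)"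
  using Psi_has_derivative by (meson DERIV_continuous continuous_on_eq_continuous_within atMost_iff)

section \<open>The stress tensor of a radial map\<close>

definition outer :: "real^'n \<Rightarrow> real^'n^'n" where
  "outer x = (\<chi> i j. x $ i * x $ j)"

lemma outer_nth [simp]: "outer x $ i $ j = x $ i * x $ j"
  by (simp add: outer_def)

lemma sum_kronecker:
  "(\<Sum>k\<in>UNIV. (if k = (i::'n::finite) then a else 0) * f k) = a * (f i :: real)"
  "(\<Sum>k\<in>UNIV. f k * (if k = (i::'n::finite) then a else 0)) = f i * (a :: real)"
  "(\<Sum>k\<in>UNIV. (if (i::'n::finite) = k then a else 0) * f k) = a * (f i :: real)"
  "(\<Sum>k\<in>UNIV. f k * (if (i::'n::finite) = k then a else 0)) = f i * (a :: real)"
  by (simp_all add: if_distrib if_distribR sum.delta sum.delta' cong: if_cong)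

lemma axis_1_nth: "axis j (1::real) $ i = (if i = j then 1 else 0)"
  by (simp add: axis_def)

text \<open>Entries lie in an arbitrary Euclidean space, so the rule can be applied twice to a
  matrix field: first to its rows, then to their entries.\<close>

lemma has_derivative_vec:
  fixes f :: "'a::real_normed_vector \<Rightarrow> 'b::euclidean_space^'n"
  assumes "\<And>i. ((\<lambda>x. f x $ i) has_derivative (\<lambda>y. f' y $ i)) (at a within S)"
  shows "(f has_derivative f') (at a within S)"
  unfolding has_derivative_componentwise_within[of f]
  by (auto simp: Basis_vec_def inner_axis intro!: has_derivative_inner_left assms)

lemma norm_matrix_power2: "(norm (A::real^'n^'m))\<^sup>2 = (\<Sum>i\<in>UNIV. \<Sum>j\<in>UNIV. (A $ i $ j)\<^sup>2)"
  unfolding power2_norm_eq_inner by (simp add: inner_vec_def power2_eq_square)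

lemma norm_vec_power2: "(norm (x::real^'n))\<^sup>2 = (\<Sum>i\<in>UNIV. (x $ i)\<^sup>2)"
  unfolding power2_norm_eq_inner by (simp add: inner_vec_def power2_eq_square)

text \<open>\<open>outer x\<close> is symmetric and its square is \<open>(norm x)^2\<close> times
  itself, so the product stays in the span of \<open>mat 1\<close> and
  \<open>outer x\<close>.\<close>

lemma transpose_mult_rank_one:
  "transpose (a *\<^sub>R mat 1 + b *\<^sub>R outer x) ** (a *\<^sub>R mat 1 + b *\<^sub>R outer x)
   = a\<^sup>2 *\<^sub>R mat 1 + (2 * a * b + b\<^sup>2 * (norm x)\<^sup>2) *\<^sub>R outer (x::real^'n)"
proof -
  have "(\<Sum>k\<in>UNIV. (a * (if k = i then 1 else 0) + b * (x $ k * x $ i)) * (a * (if k = j then 1 else 0) + b * (x $ k * x $ j)))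
      = a\<^sup>2 * (if i = j then 1 else 0) + (2 * a * b + b\<^sup>2 * (\<Sum>k\<in>UNIV. (x $ k)\<^sup>2)) * (x $ i * x $ j)" for i j
  proof -
    have "(\<Sum>k\<in>UNIV. (a * (if k = i then 1 else 0) + b * (x $ k * x $ i)) * (a * (if k = j then 1 else 0) + b * (x $ k * x $ j)))
      = (\<Sum>k\<in>UNIV. (if k = i then 1 else 0) * (a * (a * (if k = j then 1 else 0) + b * (x $ k * x $ j)))
          + (a * b * (x $ k * x $ i)) * (if k = j then 1 else 0) + b\<^sup>2 * (x $ i * x $ j) * (x $ k)\<^sup>2)"
      by (intro sum.cong refl) (simp add: algebra_simps power2_eq_square)
    also have "\<dots> = a * (a * (if i = j then 1 else 0) + b * (x $ i * x $ j)) + a * b * (x $ j * x $ i)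
        + b\<^sup>2 * (x $ i * x $ j) * (\<Sum>k\<in>UNIV. (x $ k)\<^sup>2)"
      by (simp only: sum.distrib sum_kronecker sum_distrib_left[symmetric])
    finally show ?thesis by (simp add: algebra_simps power2_eq_square)
  qed
  then show ?thesis
    by (simp add: vec_eq_iff matrix_matrix_mult_def transpose_def mat_def norm_vec_power2)
qed

text \<open>In terms of eigenvalues, the matrix acts as \<open>a\<close> on the orthogonal
  complement of \<open>x\<close> and as \<open>a + b |x|^2\<close> along \<open>x\<close>; the
  right-hand side is the sum of their squares with multiplicity.\<close>

lemma norm_rank_one_power2:
  "(norm (a *\<^sub>R mat 1 + b *\<^sub>R outer (x::real^'n)))\<^sup>2
   = (real CARD('n) - 1) * a\<^sup>2 + (a + b * (norm x)\<^sup>2)\<^sup>2"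
proof -
  have "(norm (a *\<^sub>R mat 1 + b *\<^sub>R outer x))\<^sup>2
    = (\<Sum>i\<in>UNIV. \<Sum>j\<in>UNIV. (a * (if i = j then 1 else 0) + b * (x $ i * x $ j))\<^sup>2)"
    by (simp add: norm_matrix_power2 mat_def)
  also have "\<dots> = (\<Sum>i\<in>UNIV. \<Sum>j\<in>UNIV. (if i = j then 1 else 0) * (a\<^sup>2 + 2 * a * b * (x $ i * x $ j)) + b\<^sup>2 * (x $ i)\<^sup>2 * (x $ j)\<^sup>2)"
    by (intro sum.cong refl) (simp add: algebra_simps power2_eq_square)
  also have "\<dots> = (\<Sum>i\<in>UNIV. a\<^sup>2 + 2 * a * b * (x $ i)\<^sup>2 + b\<^sup>2 * (norm x)\<^sup>2 * (x $ i)\<^sup>2)"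
    by (intro sum.cong refl, simp only: sum.distrib sum_kronecker sum_distrib_left[symmetric] norm_vec_power2)
      (simp add: algebra_simps power2_eq_square)
  also have "\<dots> = real CARD('n) * a\<^sup>2 + 2 * a * b * (norm x)\<^sup>2 + b\<^sup>2 * (norm x)\<^sup>2 * (norm x)\<^sup>2"
    by (simp only: sum.distrib sum_distrib_left[symmetric] norm_vec_power2[symmetric]) simp
  finally show ?thesis by (simp add: algebra_simps power2_eq_square)
qed

lemma has_derivative_radial_scaleR:
  fixes x :: "'a::real_inner"
  assumes "x \<noteq> 0" "(\<phi> has_real_derivative \<phi>') (at (norm x))"
  shows "((\<lambda>z. \<phi> (norm z)) has_derivative (\<lambda>y. \<phi>' * (x \<bullet> y) / norm x)) (at x)"
proof -
  have "((\<lambda>z. \<phi> (norm z)) has_derivative (\<lambda>y. \<phi>' * (sgn x \<bullet> y))) (at x)"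
    using has_derivative_compose[OF has_derivative_norm[OF assms(1)] assms(2)[unfolded has_field_derivative_def]]
    by (simp add: inner_commute)
  then show ?thesis by (simp add: sgn_div_norm divide_inverse mult_ac)
qed

text \<open>A radial map stretches by \<open>H / r\<close> in tangential directions and by
  \<open>H'\<close> in the radial one. The difference is divided by \<open>r^2\<close> because
  \<open>outer x\<close> has eigenvalue \<open>r^2\<close> along \<open>x\<close>.\<close>

lemma Jacobi_matrix_radial:
  fixes h :: "real^'n \<Rightarrow> real^'n"
  assumes "open S" "x \<in> S" "x \<noteq> 0" and h: "\<And>z. z \<in> S \<Longrightarrow> h z = radial_map H z"
    and H: "(H has_real_derivative H') (at (norm x))"
  shows "Jacobi_matrix h x = (H (norm x) / norm x) *\<^sub>R mat 1
     + ((H' - H (norm x) / norm x) / (norm x)\<^sup>2) *\<^sub>R outer x"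
proof -
  define r where "r = norm x"
  have r: "r > 0" using assms by (simp add: r_def)
  have "((\<lambda>t. H t / t) has_real_derivative (H' * r - H r) / (r * r)) (at (norm x))"
    using DERIV_divide[OF H DERIV_ident] r by (simp add: r_def)
  from has_derivative_scaleR[OF has_derivative_radial_scaleR[OF \<open>x \<noteq> 0\<close> this] has_derivative_ident]
  have "((\<lambda>z. (H (norm z) / norm z) *\<^sub>R z) has_derivative
     (\<lambda>y. (H r / r) *\<^sub>R y + ((H' * r - H r) / (r * r) * (x \<bullet> y) / r) *\<^sub>R x)) (at x)"
    by (simp add: r_def)
  then have "(h has_derivative (\<lambda>y. (H r / r) *\<^sub>R y + ((H' * r - H r) / (r * r) * (x \<bullet> y) / r) *\<^sub>R x)) (at x)"
    by (rule has_derivative_transform_within_open[OF _ assms(1,2)])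
      (simp add: h radial_map_def divide_inverse)
  from frechet_derivative_at[OF this, symmetric]
  have "Jacobi_matrix h x $ i $ j = H r / r * (if i = j then 1 else 0) + ((H' * r - H r) / (r * r) * x $ j / r) * x $ i" for i j
    by (simp add: Jacobi_matrix_def matrix_def axis_1_nth inner_axis flip: r_def)
  moreover have "(H' * r - H r) / (r * r) * a / r * b = (H' - H r / r) / r\<^sup>2 * (b * a)" for a b
    using r by (simp add: field_simps power2_eq_square)
  ultimately have "Jacobi_matrix h x $ i $ j = H r / r * (if i = j then 1 else 0) + (H' - H r / r) / r\<^sup>2 * (x $ i * x $ j)" for i j
    by (simp only:)
  then show ?thesis
    by (simp add: vec_eq_iff mat_def r_def)
qed

text \<open>The scalar coefficient \<open>B\<close> of the stress tensor at radius \<open>t\<close>,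
  where \<open>d\<close> is the value of the metric, \<open>y = H t\<close> and
  \<open>p = H' t\<close>; the square root is the Hilbert-Schmidt norm of the differential.\<close>

definition radial_stress :: "nat \<Rightarrow> real \<Rightarrow> real \<Rightarrow> real \<Rightarrow> real \<Rightarrow> real" where
  "radial_stress n d t y p = d * sqrt ((real n - 1) * (y / t)\<^sup>2 + p\<^sup>2) ^ (n - 2) * (p\<^sup>2 - (y / t)\<^sup>2)"

lemma stress_radial:
  fixes h :: "real^'n \<Rightarrow> real^'n"
  assumes n: "CARD('n) \<ge> 3" and "open S" "x \<in> S" "x \<noteq> 0" and h: "\<And>z. z \<in> S \<Longrightarrow> h z = radial_map H z"
    and H: "(H has_real_derivative H') (at (norm x))" and pos: "H (norm x) > 0"
    and B: "B = radial_stress CARD('n) (\<rho> (H (norm x))) (norm x) (H (norm x)) H'"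
  shows "stress \<rho> h x = (B / (norm x)\<^sup>2) *\<^sub>R outer x - (B / real CARD('n)) *\<^sub>R mat 1"
proof -
  define r where "r = norm x"
  have r: "r > 0" using assms by (simp add: r_def)
  define a where "a = H r / r"
  define b where "b = (H' - a) / r\<^sup>2"
  let ?n = "real CARD('n)"
  have D: "Jacobi_matrix h x = a *\<^sub>R mat 1 + b *\<^sub>R outer x"
    using Jacobi_matrix_radial[OF assms(2-6)] by (simp add: a_def b_def r_def)
  have hn: "norm (h x) = H r" using h[OF \<open>x \<in> S\<close>] pos \<open>x \<noteq> 0\<close> by (simp add: radial_map_def r_def)
  have br: "a + b * r\<^sup>2 = H'" using r by (simp add: b_def)
  define N where "N = norm (Jacobi_matrix h x)"
  have N2: "N\<^sup>2 = (?n - 1) * a\<^sup>2 + H'\<^sup>2"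
    using norm_rank_one_power2[of a b x] br by (simp add: N_def D r_def)
  then have N: "N = sqrt ((?n - 1) * a\<^sup>2 + H'\<^sup>2)"
    by (metis N_def norm_ge_zero real_sqrt_abs abs_of_nonneg)
  define d where "d = \<rho> (H r)"
  have B': "B = d * N ^ (CARD('n) - 2) * (H'\<^sup>2 - a\<^sup>2)"
    unfolding B radial_stress_def N a_def d_def r_def by simp
  have c: "2 * a * b + b\<^sup>2 * r\<^sup>2 = (H'\<^sup>2 - a\<^sup>2) / r\<^sup>2"
  proof -
    have "(2 * a * b + b\<^sup>2 * r\<^sup>2) * r\<^sup>2 = (a + b * r\<^sup>2)\<^sup>2 - a\<^sup>2"
      by (simp add: power2_eq_square algebra_simps)
    then show ?thesis using r br by (simp add: field_simps)
  qed
  have "CARD('n) - 2 + 2 = CARD('n)" using n by simp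
  then have Nn: "N ^ CARD('n) = N ^ (CARD('n) - 2) * N\<^sup>2"
    unfolding power_add[symmetric] by (simp only:)
  \<comment> \<open>Writing \<open>N^n = N^(n-2) N^2\<close> with
    \<open>N^2 = (n-1) a^2 + H'^2\<close> gives \<open>a^2 - N^2 / n = (a^2 - H'^2) / n\<close>, so
    the identity part has coefficient \<open>- B / n\<close>.\<close>
  have e: "d * N ^ (CARD('n) - 2) * a\<^sup>2 - d / ?n * N ^ CARD('n) = - (B / ?n)"
    unfolding Nn B' N2 using n by (simp add: divide_simps) (simp add: algebra_simps)
  have "stress \<rho> h x = (d * N ^ (CARD('n) - 2)) *\<^sub>R (a\<^sup>2 *\<^sub>R mat 1 + (2 * a * b + b\<^sup>2 * r\<^sup>2) *\<^sub>R outer x)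
      - (d / ?n * N ^ CARD('n)) *\<^sub>R mat 1"
    unfolding stress_def Let_def hn N_def[symmetric] d_def[symmetric]
    unfolding D transpose_mult_rank_one r_def ..
  also have "\<dots> = (d * N ^ (CARD('n) - 2) * a\<^sup>2 - d / ?n * N ^ CARD('n)) *\<^sub>R mat 1 + (B / r\<^sup>2) *\<^sub>R outer x"
    unfolding c B' by (simp add: algebra_simps)
  finally show ?thesis unfolding e r_def by simp
qed

text \<open>The factor \<open>B' + n B / r\<close> is \<open>r^(-n)\<close> times the derivative of
  \<open>r^n B\<close>, so for such fields zero divergence means conservation of
  \<open>r^n B\<close>.\<close>

lemma Div_radial:
  fixes M :: "real^'n \<Rightarrow> real^'n^'n"
  assumes "open S" "x \<in> S" "x \<noteq> 0"
    and M: "\<And>z. z \<in> S \<Longrightarrow> M z = (B (norm z) / (norm z)\<^sup>2) *\<^sub>R outer z - (B (norm z) / real CARD('n)) *\<^sub>R mat 1"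
    and B: "(B has_real_derivative B') (at (norm x))"
  shows "M differentiable (at x)"
    and "Div M x = ((real CARD('n) - 1) / (real CARD('n) * norm x) * (B' + real CARD('n) * B (norm x) / norm x)) *\<^sub>R x"
proof -
  define r where "r = norm x"
  have r: "r > 0" using assms by (simp add: r_def)
  let ?n = "real CARD('n)"
  define b where "b = B'/ r\<^sup>2 - 2 * B r / r ^ 3"
  have "((\<lambda>t. B t / t\<^sup>2) has_real_derivative b) (at (norm x))"
    unfolding r_def[symmetric]
    by (rule derivative_eq_intros B[folded r_def] refl)+ (use r in \<open>auto simp: b_def field_simps power2_eq_square power3_eq_cube\<close>)
  note b = has_derivative_radial_scaleR[OF \<open>x \<noteq> 0\<close> this, folded r_def]
  have "((\<lambda>t. B t / ?n) has_real_derivative B' / ?n) (at (norm x))"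
    by (rule DERIV_cdivide[OF B])
  note B2 = has_derivative_radial_scaleR[OF \<open>x \<noteq> 0\<close> this, folded r_def]
  have nth: "((\<lambda>z. z $ i) has_derivative (\<lambda>y. y $ i)) (at x)" for i
    by (rule bounded_linear_imp_has_derivative) (rule bounded_linear_vec_nth)
  define M' where "M' = (\<lambda>y. \<chi> i j. B r / r\<^sup>2 * (x $ i * y $ j + y $ i * x $ j) + b * (x \<bullet> y) / r * (x $ i * x $ j)
       - (B' / ?n * (x \<bullet> y) / r) * (if i = j then 1 else 0))"
  have "((\<lambda>z. \<chi> i j. (B (norm z) / (norm z)\<^sup>2) * (z $ i * z $ j) - (B (norm z) / ?n) * (if i = j then 1 else 0))
      has_derivative M') (at x)"
    unfolding M'_def
  proof (rule has_derivative_vec, rule has_derivative_vec, unfold vec_lambda_beta)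
    fix i j
    show "((\<lambda>z. (B (norm z) / (norm z)\<^sup>2) * (z $ i * z $ j) - (B (norm z) / ?n) * (if i = j then 1 else 0)) has_derivative
       (\<lambda>y. B r / r\<^sup>2 * (x $ i * y $ j + y $ i * x $ j) + b * (x \<bullet> y) / r * (x $ i * x $ j)
       - (B' / ?n * (x \<bullet> y) / r) * (if i = j then 1 else 0))) (at x)"
      using has_derivative_diff[OF has_derivative_mult[OF b has_derivative_mult[OF nth[of i] nth[of j]]]
          has_derivative_mult[OF B2 has_derivative_const[of "if i = j then 1 else 0"]]] by (simp add: r_def)
  qed
  then have D: "(M has_derivative M') (at x)"
    by (rule has_derivative_transform_within_open[OF _ assms(1,2)]) (simp add: M vec_eq_iff mat_def)
  then show "M differentiable (at x)" by (auto simp: differentiable_def)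
  have f: "frechet_derivative M (at x) = M'"
    using frechet_derivative_at[OF D] by simp
  have "Div M x $ i = ((?n - 1) / (?n * r) * (B' + ?n * B r / r)) * x $ i" for i
  proof -
    have "Div M x $ i = (\<Sum>j\<in>UNIV. B r / r\<^sup>2 * (x $ i * 1 + (if i = j then 1 else 0) * x $ j) + b * x $ j / r * (x $ i * x $ j)
       - (B' / ?n * x $ j / r) * (if i = j then 1 else 0))"
      unfolding Div_def f M'_def by (simp add: inner_axis axis_1_nth)
    also have "\<dots> = (\<Sum>j\<in>UNIV. B r / r\<^sup>2 * x $ i + (if i = j then 1 else 0) * (B r / r\<^sup>2 * x $ j - B' / ?n * x $ j / r) + (b / r * x $ i) * (x $ j)\<^sup>2)"
      by (intro sum.cong refl) (simp add: algebra_simps power2_eq_square)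
    \<comment> \<open>Summing over \<open>j\<close>, the constant term counts \<open>n\<close>
      times, the Kronecker term survives once, and the squares add up to \<open>r^2\<close>.\<close>
    also have "\<dots> = ?n * (B r / r\<^sup>2 * x $ i) + (B r / r\<^sup>2 * x $ i - B' / ?n * x $ i / r) + (b / r * x $ i) * r\<^sup>2"
      unfolding r_def norm_vec_power2
      by (simp only: sum.distrib sum_kronecker sum_distrib_left[symmetric]) simp
    also have "\<dots> = ((?n - 1) / (?n * r) * (B' + ?n * B r / r)) * x $ i"
      using r unfolding b_def by (simp add: divide_simps power2_eq_square power3_eq_cube) (simp add: algebra_simps)
    finally show ?thesis .
  qed
  then show "Div M x = ((?n - 1) / (?n * norm x) * (B' + ?n * B (norm x) / norm x)) *\<^sub>R x"
    by (simp add: vec_eq_iff r_def)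
qed

section \<open>The first integral\<close>

lemma sqrt_power_eq_powr:
  assumes "n \<ge> 3" "x > 0" shows "sqrt x ^ (n - 2) = x powr ((real n - 2) / 2)"
proof -
  have "sqrt x ^ (n - 2) = (x powr (1/2)) powr real (n - 2)"
    by (metis assms(2) less_imp_le powr_half_sqrt powr_realpow real_sqrt_gt_zero)
  also have "\<dots> = x powr ((real n - 2) / 2)"
    using assms by (simp add: powr_powr of_nat_diff)
  finally show ?thesis .
qed

text \<open>Pulling \<open>y / t\<close> out of the square root and out of the last factor collects
  \<open>(y / t)^n\<close>, and the remainder is \<open>Phi\<close> at \<open>(t p / y)^2\<close>.
  Thus conservation of \<open>t^n B\<close> is the first integral.\<close>

lemma radial_stress_eq_Phi:
  assumes n: "n \<ge> 3" and "t > 0" "y > 0"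
  shows "t ^ n * radial_stress n d t y p = - (sqrt (real n - 1) ^ (n - 2) * (d * y ^ n * Phi n ((t * p / y)\<^sup>2)))"
proof -
  define \<zeta> where "\<zeta> = (t * p / y)\<^sup>2"
  define k where "k = real n - 1"
  have k: "k > 0" using n by (simp add: k_def)
  have \<zeta>: "\<zeta> \<ge> 0" by (simp add: \<zeta>_def)
  have p: "p\<^sup>2 = (y / t)\<^sup>2 * \<zeta>" using assms by (simp add: \<zeta>_def field_simps)
  have 1: "k * (y / t)\<^sup>2 + p\<^sup>2 = k * (y / t)\<^sup>2 * (1 + \<zeta> / k)"
    unfolding p using k by (simp add: distrib_left)
  have 2: "sqrt (k * (y / t)\<^sup>2 + p\<^sup>2) = sqrt k * (y / t) * sqrt (1 + \<zeta> / k)"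
    unfolding 1 using assms by (simp add: real_sqrt_mult)
  have 3: "p\<^sup>2 - (y / t)\<^sup>2 = - ((y / t)\<^sup>2 * (1 - \<zeta>))"
    unfolding p by (simp add: algebra_simps)
  have "1 + \<zeta> / k > 0" using k \<zeta> by (simp add: add_pos_nonneg)
  then have 4: "sqrt (1 + \<zeta> / k) ^ (n - 2) = (1 + \<zeta> / k) powr ((real n - 2) / 2)"
    using n by (rule sqrt_power_eq_powr[rotated])
  have "n - 2 + 2 = n" using n by simp
  then have 5: "(y / t) ^ (n - 2) * (y / t)\<^sup>2 = (y / t) ^ n"
    unfolding power_add[symmetric] by (simp only:)
  have "radial_stress n d t y p = - (d * (sqrt k ^ (n - 2) * ((y / t) ^ (n - 2) * (y / t)\<^sup>2) * Phi n \<zeta>))"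
    unfolding radial_stress_def k_def[symmetric] 2 3 Phi_def power_mult_distrib 4 by (simp add: algebra_simps)
  then have "t ^ n * radial_stress n d t y p = - (sqrt k ^ (n - 2) * (d * (t ^ n * (y / t) ^ n) * Phi n \<zeta>))"
    unfolding 5 by simp
  also have "t ^ n * (y / t) ^ n = y ^ n" using assms by (simp flip: power_mult_distrib)
  finally show ?thesis unfolding k_def \<zeta>_def .
qed

lemma open_annulus: "open (annulus r s :: 'a::real_normed_vector set)"
  unfolding annulus_def by (intro open_Collect_conj open_Collect_less continuous_intros)

lemma annulus_nonzero: "x \<in> annulus 1 R \<Longrightarrow> x \<noteq> 0"
  by (auto simp: annulus_def)

lemma inner_variation_eqI:
  fixes h :: "real^'n \<Rightarrow> real^'n"
  assumes n: "CARD('n) \<ge> 3"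
    and h: "\<And>x. x \<in> annulus 1 R \<Longrightarrow> h x = radial_map H x"
    and H: "\<And>t. t \<in> {1<..<R} \<Longrightarrow> (H has_real_derivative H' t) (at t)"
    and pos: "\<And>t. t \<in> {1<..<R} \<Longrightarrow> H t > 0"
    and c: "\<And>t. t \<in> {1<..<R} \<Longrightarrow> \<rho> (H t) * H t ^ CARD('n) * Phi CARD('n) ((t * H' t / H t)\<^sup>2) = c"
  shows "inner_variation_eq \<rho> R h"
proof -
  let ?n = "CARD('n)"
  define K where "K = sqrt (real ?n - 1) ^ (?n - 2) * c"
  \<comment> \<open>The first integral forces \<open>t^n B = - K\<close>, so \<open>B\<close> is an
    explicit power of the radius and is differentiated as such, without differentiating
    \<open>H'\<close> or the metric.\<close>
  define B where "B = (\<lambda>t. - K / t ^ ?n)"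
  have B: "B t = radial_stress ?n (\<rho> (H t)) t (H t) (H' t)" if "t \<in> {1<..<R}" for t
    using radial_stress_eq_Phi[OF n, of t "H t" "\<rho> (H t)" "H' t"] that pos[OF that] c[OF that]
    by (simp add: B_def K_def field_simps)
  have stress: "stress \<rho> h x = (B (norm x) / (norm x)\<^sup>2) *\<^sub>R outer x - (B (norm x) / real ?n) *\<^sub>R mat 1"
    if "x \<in> annulus 1 R" for x
  proof -
    have nx: "norm x \<in> {1<..<R}" using that by (simp add: annulus_def)
    show ?thesis
      by (rule stress_radial[OF n open_annulus that annulus_nonzero[OF that] _ H[OF nx] pos[OF nx]])
        (simp_all add: h B[OF nx])
  qed
  have dB: "(B has_real_derivative K * real ?n * t ^ (?n - 1) / (t ^ ?n * t ^ ?n)) (at t)" if "t > 0" for t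
    unfolding B_def using DERIV_divide[OF DERIV_const[of "- K"] DERIV_power[OF DERIV_ident], of t ?n UNIV] that by (simp add: mult.assoc)
  show ?thesis
    unfolding inner_variation_eq_def
  proof
    fix x :: "real^'n" assume x: "x \<in> annulus 1 R"
    then have r: "norm x > 0" by (auto simp: annulus_def)
    note D = Div_radial[OF open_annulus x annulus_nonzero[OF x] stress dB[OF r]]
    define r where "r = norm x"
    have "K * real ?n * r ^ (?n - 1) / (r ^ ?n * r ^ ?n) + real ?n * B r / r = 0"
      using r power_Suc[of r "?n - 1"] n unfolding B_def r_def[symmetric] by (simp add: field_simps)
    then show "stress \<rho> h differentiable at x \<and> Div (stress \<rho> h) x = 0"
      using D by (simp add: r_def)
  qed
qed

lemma inner_variation_eqD:
  fixes h :: "real^'n \<Rightarrow> real^'n"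
  assumes n: "CARD('n) \<ge> 3"
    and h: "\<And>x. x \<in> annulus 1 R \<Longrightarrow> h x = radial_map H x"
    and H: "\<And>t. t \<in> {1<..<R} \<Longrightarrow> (H has_real_derivative H' t) (at t)"
    and H': "\<And>t. t \<in> {1<..<R} \<Longrightarrow> H' differentiable (at t)"
    and pos: "\<And>t. t \<in> {1<..<R} \<Longrightarrow> H t > 0"
    and \<rho>: "\<And>t. t \<in> {1<..<R} \<Longrightarrow> \<rho> differentiable (at (H t))"
    and eq: "inner_variation_eq \<rho> R h"
  obtains c where "\<And>t. t \<in> {1<..<R} \<Longrightarrow> \<rho> (H t) * H t ^ CARD('n) * Phi CARD('n) ((t * H' t / H t)\<^sup>2) = c"
proof -
  let ?n = "CARD('n)"
  define B where "B = (\<lambda>t. radial_stress ?n (\<rho> (H t)) t (H t) (H' t))"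
  have stress: "stress \<rho> h x = (B (norm x) / (norm x)\<^sup>2) *\<^sub>R outer x - (B (norm x) / real ?n) *\<^sub>R mat 1"
    if "x \<in> annulus 1 R" for x
  proof -
    have nx: "norm x \<in> {1<..<R}" using that by (simp add: annulus_def)
    show ?thesis
      by (rule stress_radial[OF n open_annulus that annulus_nonzero[OF that] _ H[OF nx] pos[OF nx]])
        (simp_all add: h B_def)
  qed
  have "((\<lambda>t. t ^ ?n * B t) has_real_derivative 0) (at t)" if t: "t \<in> {1<..<R}" for t
  proof -
    have t0: "t > 0" using t by simp
    obtain H'' where H'': "(H' has_real_derivative H'') (at t)"
      using H'[OF t] by (auto simp: real_differentiable_def)
    obtain \<rho>' where "(\<rho> has_real_derivative \<rho>') (at (H t))"
      using \<rho>[OF t] by (auto simp: real_differentiable_def)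
    from DERIV_chain2[OF this H[OF t]]
    have d\<rho>: "((\<lambda>t. \<rho> (H t)) has_real_derivative \<rho>' * H' t) (at t)" .
    have q: "((\<lambda>t. (H t / t)\<^sup>2) has_real_derivative 2 * (H t / t) * ((H' t * t - H t) / (t * t))) (at t)"
      by (rule derivative_eq_intros H[OF t] refl)+ (use t0 in \<open>auto simp: mult_ac\<close>)
    have p: "((\<lambda>t. (H' t)\<^sup>2) has_real_derivative 2 * H' t * H'') (at t)"
      by (rule derivative_eq_intros H'' refl)+ simp
    have k: "0 < real ?n - 1" using n by simp
    then have "0 < (real ?n - 1) * (H t / t)\<^sup>2 + (H' t)\<^sup>2"
      using pos[OF t] t0 by (intro add_pos_nonneg) auto
    from DERIV_chain2[where f = sqrt and g = "\<lambda>t. (real ?n - 1) * (H t / t)\<^sup>2 + (H' t)\<^sup>2",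
        OF DERIV_real_sqrt[OF this] DERIV_add[OF DERIV_cmult[OF q] p]]
    obtain B' where B': "(B has_real_derivative B') (at t)"
      unfolding B_def radial_stress_def
      using DERIV_mult[OF DERIV_mult[OF d\<rho> DERIV_power] DERIV_diff[OF p q]] by blast
    \<comment> \<open>Testing the vector equation at one point of norm \<open>t\<close>, on a
      coordinate axis, suffices because the divergence is a scalar multiple of
      \<open>x\<close>.\<close>
    define x :: "real^'n" where "x = t *\<^sub>R axis undefined 1"
    have nx: "norm x = t" using t0 by (simp add: x_def)
    then have x: "x \<in> annulus 1 R" using t by (simp add: annulus_def)
    have "Div (stress \<rho> h) x = ((real ?n - 1) / (real ?n * t) * (B' + real ?n * B t / t)) *\<^sub>R x"
      using Div_radial(2)[OF open_annulus x annulus_nonzero[OF x] stress B'[folded nx]] by (simp add: nx)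
    moreover have "Div (stress \<rho> h) x = 0" using eq x by (simp add: inner_variation_eq_def)
    ultimately have "B' + real ?n * B t / t = 0"
      using annulus_nonzero[OF x] k t0 by simp
    moreover have "((\<lambda>t. t ^ ?n * B t) has_real_derivative t ^ ?n * B' + real ?n * t ^ (?n - 1) * B t) (at t)"
      by (rule derivative_eq_intros B' refl)+ simp
    moreover have "t ^ ?n * B' + real ?n * t ^ (?n - 1) * B t = t ^ ?n * (B' + real ?n * B t / t)"
      using t0 n by (cases ?n) (simp_all add: field_simps)
    ultimately show ?thesis by simp
  qed
  then have "\<exists>b. \<forall>t\<in>{1<..<R}. t ^ ?n * B t = b"
    by (intro has_field_derivative_zero_constant) (auto intro: has_field_derivative_at_within)
  then obtain b where b: "\<And>t. t \<in> {1<..<R} \<Longrightarrow> t ^ ?n * B t = b" by blast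
  show thesis
  proof (rule that)
    fix t assume t: "t \<in> {1<..<R}"
    define K where "K = sqrt (real ?n - 1) ^ (?n - 2)"
    have "K > 0" using n by (simp add: K_def)
    moreover have "b = - (K * (\<rho> (H t) * H t ^ ?n * Phi ?n ((t * H' t / H t)\<^sup>2)))"
      using radial_stress_eq_Phi[OF n, of t "H t" "\<rho> (H t)" "H' t"] b[OF t] t pos[OF t]
      by (simp add: B_def K_def)
    ultimately show "\<rho> (H t) * H t ^ ?n * Phi ?n ((t * H' t / H t)\<^sup>2) = - b / K"
      by (simp add: field_simps)
  qed
qed

section \<open>Inverting the integral of a reciprocal\<close>

text \<open>Solves \<open>G' = g(G)\<close> by inverting \<open>L\<close>, the integral of
  \<open>1/g\<close>. The function \<open>f\<close> is the reciprocal of \<open>g\<close> only off a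
  negligible set, so \<open>g\<close> may vanish on such a set; there \<open>inverse\<close> has the
  value 0.\<close>

locale reciprocal_integral =
  fixes a b :: real and g f :: "real \<Rightarrow> real"
  assumes a_less_b: "a < b"
    and continuous_g: "continuous_on {a..b} g"
    and integrable_f: "f integrable_on {a..b}"
    and f_nonneg: "\<And>y. y \<in> {a..b} \<Longrightarrow> 0 \<le> f y"
    and reciprocal: "negligible {y \<in> {a..b}. g y * f y \<noteq> 1}"
begin

definition L :: "real \<Rightarrow> real" where "L s = integral {a..s} f"

definition G :: "real \<Rightarrow> real" where "G = the_inv_into {a..b} L"

lemma has_integral_f:
  assumes "a \<le> s" "s \<le> s'" "s' \<le> b"
  shows "(f has_integral L s' - L s) {s..s'}"
proof -
  have "f integrable_on {a..s'}" "f integrable_on {s..s'}"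
    using integrable_f assms by (auto intro: integrable_on_subinterval)
  moreover have "L s + integral {s..s'} f = L s'"
    unfolding L_def using assms calculation by (intro Henstock_Kurzweil_Integration.integral_combine) auto
  ultimately show ?thesis by (metis add_diff_cancel_left' integrable_integral)
qed

lemma has_integral_gf:
  assumes "a \<le> s" "s \<le> s'" "s' \<le> b"
  shows "((\<lambda>y. g y * f y) has_integral s' - s) {s..s'}"
proof (rule has_integral_spike[OF reciprocal])
  show "((\<lambda>_. 1) has_integral s' - s) {s..s'}"
    using has_integral_const_real[of "1::real" s s'] assms by simp
qed (use assms in auto)

text \<open>The integral of \<open>g f\<close> is \<open>s' - s\<close> and that of \<open>f\<close>
  is \<open>L s' - L s\<close>, so the claim is the integral of
  \<open>\<bar>g - k\<bar> f \<le> e f\<close>. It controls increments even where \<open>g\<close>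
  vanishes.\<close>

lemma mean_value_bound:
  assumes "a \<le> s" "s \<le> s'" "s' \<le> b" and k: "\<And>y. y \<in> {s..s'} \<Longrightarrow> \<bar>g y - k\<bar> \<le> e"
  shows "\<bar>(s' - s) - k * (L s' - L s)\<bar> \<le> e * (L s' - L s)"
proof -
  have d: "((\<lambda>y. g y * f y - k * f y) has_integral (s' - s) - k * (L s' - L s)) {s..s'}"
    by (intro has_integral_diff has_integral_gf has_integral_mult_right has_integral_f assms)
  have e: "((\<lambda>y. e * f y) has_integral e * (L s' - L s)) {s..s'}"
    by (intro has_integral_mult_right has_integral_f assms)
  have *: "\<bar>g y * f y - k * f y\<bar> \<le> e * f y" if "y \<in> {s..s'}" for y
  proof -
    have "\<bar>g y - k\<bar> * f y \<le> e * f y"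
      using k[OF that] f_nonneg[of y] that assms by (intro mult_right_mono) auto
    then show ?thesis using f_nonneg[of y] that assms by (simp add: abs_mult flip: left_diff_distrib)
  qed
  have "(s' - s) - k * (L s' - L s) \<le> e * (L s' - L s)"
    by (rule has_integral_le[OF d e]) (use * in \<open>force simp: abs_le_iff\<close>)
  moreover have "- ((s' - s) - k * (L s' - L s)) \<le> e * (L s' - L s)"
    by (rule has_integral_le[OF has_integral_neg[OF d] e]) (use * in \<open>force simp: abs_le_iff\<close>)
  ultimately show ?thesis by linarith
qed

lemma L_strict_mono:
  assumes "a \<le> s" "s < s'" "s' \<le> b" shows "L s < L s'"
proof -
  have "0 \<le> L s' - L s"
    using has_integral_nonneg[OF has_integral_f[of s s']] f_nonneg assms by auto
  moreover have "L s' - L s \<noteq> 0"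
  proof
    assume 0: "L s' - L s = 0"
    \<comment> \<open>With \<open>k = 0\<close> and \<open>e\<close> a bound of \<open>g\<close>,
      \<open>mean_value_bound\<close> turns a zero increment of \<open>L\<close> into
      \<open>s' - s \<le> 0\<close>.\<close>
    have "bounded (g ` {a..b})"
      by (intro compact_imp_bounded compact_continuous_image continuous_g) auto
    then obtain K where "\<forall>y\<in>{a..b}. \<bar>g y\<bar> \<le> K" unfolding bounded_iff by auto
    then have "\<bar>(s' - s) - 0 * (L s' - L s)\<bar> \<le> K * (L s' - L s)"
      using assms by (intro mean_value_bound) auto
    then show False using 0 assms by simp
  qed
  ultimately show ?thesis by simp
qed

lemma L_a [simp]: "L a = 0" by (simp add: L_def)

lemma L_less_iff: "s \<in> {a..b} \<Longrightarrow> s' \<in> {a..b} \<Longrightarrow> L s < L s' \<longleftrightarrow> s < s'"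
  by (metis L_strict_mono atLeastAtMost_iff linorder_cases order_less_imp_not_less order_less_irrefl)

lemma L_inj: "inj_on L {a..b}"
  by (rule linorder_inj_onI) (use L_strict_mono in force)+

lemma continuous_L: "continuous_on {a..b} L"
  unfolding L_def using indefinite_integral_continuous_1[OF integrable_f] .

lemma L_image: "L ` {a..b} = {0..L b}"
proof
  show "L ` {a..b} \<subseteq> {0..L b}"
  proof (clarify, simp)
    fix s assume "a \<le> s \<and> s \<le> b"
    then show "0 \<le> L s \<and> L s \<le> L b"
      using L_strict_mono[of a s] L_strict_mono[of s b] a_less_b
      by (metis L_a less_eq_real_def order_refl)
  qed
  show "{0..L b} \<subseteq> L ` {a..b}"
  proof
    fix \<tau> assume "\<tau> \<in> {0..L b}"
    then obtain s where "a \<le> s" "s \<le> b" "L s = \<tau>"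
      using IVT'[of L a \<tau> b] a_less_b continuous_L by auto
    then show "\<tau> \<in> L ` {a..b}" by auto
  qed
qed

lemma G_L: "s \<in> {a..b} \<Longrightarrow> G (L s) = s"
  unfolding G_def by (rule the_inv_into_f_f[OF L_inj])

lemma L_G: "\<tau> \<in> {0..L b} \<Longrightarrow> L (G \<tau>) = \<tau>"
  unfolding G_def by (rule f_the_inv_into_f[OF L_inj]) (simp add: L_image)

lemma G_in: "\<tau> \<in> {0..L b} \<Longrightarrow> G \<tau> \<in> {a..b}"
  unfolding G_def using the_inv_into_into[OF L_inj, of \<tau> "{a..b}"] L_image by blast

lemma G_less_iff: "\<tau> \<in> {0..L b} \<Longrightarrow> \<tau>' \<in> {0..L b} \<Longrightarrow> G \<tau> < G \<tau>' \<longleftrightarrow> \<tau> < \<tau>'"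
  using L_less_iff[of "G \<tau>" "G \<tau>'"] by (simp add: L_G G_in del: atLeastAtMost_iff)

lemma G_interior: "\<tau> \<in> {0<..<L b} \<Longrightarrow> G \<tau> \<in> {a<..<b}"
  using G_less_iff[of 0 \<tau>] G_less_iff[of \<tau> "L b"] G_L[of a] G_L[of b] a_less_b by simp

lemma L_interior: "s \<in> {a<..<b} \<Longrightarrow> L s \<in> {0<..<L b}"
  using L_strict_mono[of a s] L_strict_mono[of s b] by simp

lemma continuous_G: "continuous_on {0..L b} G"
  using continuous_on_inv[OF continuous_L compact_Icc] G_L by (simp add: L_image)

text \<open>The increments satisfy \<open>G \<tau>' - G \<tau> = \<integral> g f\<close>, taken from \<open>G \<tau>\<close> to \<open>G \<tau>'\<close>, which is
  \<open>g (G \<tau>) (\<tau>' - \<tau>)\<close> up to a small relative error; in contrast to the inverse function rule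
  this covers \<open>g (G \<tau>) = 0\<close>.\<close>

lemma G_has_derivative:
  assumes "\<tau> \<in> {0<..<L b}"
  shows "(G has_real_derivative g (G \<tau>)) (at \<tau>)"
proof -
  have "(G has_derivative (*) (g (G \<tau>))) (at \<tau> within {0<..<L b})"
    unfolding has_derivative_within_alt
  proof (intro conjI allI impI bounded_linear_mult_right)
    fix e :: real assume "e > 0"
    have y0: "G \<tau> \<in> {a..b}" using G_in assms by simp
    have "\<exists>d>0. \<forall>y\<in>{a..b}. dist y (G \<tau>) < d \<longrightarrow> dist (g y) (g (G \<tau>)) < e"
      using continuous_g[unfolded continuous_on_iff] y0 \<open>e > 0\<close> by blast
    then obtain d where d: "d > 0" "\<And>y. y \<in> {a..b} \<Longrightarrow> dist y (G \<tau>) < d \<Longrightarrow> dist (g y) (g (G \<tau>)) < e"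
      by blast
    have "\<exists>d'>0. \<forall>t\<in>{0..L b}. dist t \<tau> < d' \<longrightarrow> dist (G t) (G \<tau>) < d"
      using continuous_G[unfolded continuous_on_iff] assms d(1)
      by (meson atLeastAtMost_iff greaterThanLessThan_iff less_eq_real_def)
    then obtain d' where d': "d' > 0" "\<And>t. t \<in> {0..L b} \<Longrightarrow> dist t \<tau> < d' \<Longrightarrow> dist (G t) (G \<tau>) < d"
      by blast
    have "norm (G t - G \<tau> - g (G \<tau>) * (t - \<tau>)) \<le> e * norm (t - \<tau>)"
      if t: "t \<in> {0<..<L b}" "norm (t - \<tau>) < d'" for t
    proof -
      have Gt: "G t \<in> {a..b}" "L (G t) = t" "L (G \<tau>) = \<tau>" using G_in L_G t assms by auto
      have near: "dist (G t) (G \<tau>) < d" using d' t by (simp add: dist_norm)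
      show ?thesis
      proof (cases "\<tau> \<le> t")
        case True
        then have le: "G \<tau> \<le> G t" using G_less_iff[of t \<tau>] t assms by simp
        have "\<bar>g y - g (G \<tau>)\<bar> \<le> e" if "y \<in> {G \<tau>..G t}" for y
          using d(2)[of y] that near y0 Gt by (auto simp: dist_real_def)
        from mean_value_bound[OF _ le _ this] True Gt y0 show ?thesis by simp
      next
        case False
        then have le: "G t \<le> G \<tau>" using G_less_iff[of \<tau> t] t assms by simp
        have "\<bar>g y - g (G \<tau>)\<bar> \<le> e" if "y \<in> {G t..G \<tau>}" for y
          using d(2)[of y] that near y0 Gt by (auto simp: dist_real_def)
        from mean_value_bound[OF _ le _ this] False Gt y0
        show ?thesis by (simp add: abs_le_iff algebra_simps)
      qed
    qed
    then show "\<exists>d>0. \<forall>t\<in>{0<..<L b}. norm (t - \<tau>) < d \<longrightarrow>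
        norm (G t - G \<tau> - g (G \<tau>) * (t - \<tau>)) \<le> e * norm (t - \<tau>)"
      using d' by blast
  qed
  then show ?thesis
    using assms by (simp add: has_field_derivative_def at_within_open[of _ "{0<..<L b}"])
qed

end

text \<open>Where \<open>W\<close> is positive the chain rule cancels the root. At a zero of
  \<open>W\<close> the chain rule fails, but \<open>k\<close> is small nearby, so a regularised root
  has small slope and \<open>sqrt (W x)\<close> is bounded by
  \<open>e \<bar>x - t\<bar>\<close>.\<close>

lemma DERIV_sqrt_of_ode:
  fixes W k :: "real \<Rightarrow> real"
  assumes S: "open S" "t \<in> S"
    and W: "\<And>x. x \<in> S \<Longrightarrow> (W has_real_derivative 2 * k x * sqrt (W x)) (at x)"
    and nonneg: "\<And>x. x \<in> S \<Longrightarrow> 0 \<le> W x"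
    and k: "isCont k t" "W t = 0 \<Longrightarrow> k t = 0"
  shows "((\<lambda>x. sqrt (W x)) has_real_derivative k t) (at t)"
proof (cases "W t = 0")
  case False
  then have "W t > 0" using nonneg S by force
  then show ?thesis
    using DERIV_chain2[OF DERIV_real_sqrt W[OF \<open>t \<in> S\<close>]] by (simp add: field_simps)
next
  case True
  have "((\<lambda>x. sqrt (W x)) has_derivative (*) 0) (at t)"
    unfolding has_derivative_within_alt
  proof (intro conjI allI impI bounded_linear_mult_right)
    fix e :: real assume e: "e > 0"
    obtain d1 where d1: "d1 > 0" "ball t d1 \<subseteq> S" using S open_contains_ball by blast
    obtain d2 where d2: "d2 > 0" "\<And>x. dist x t < d2 \<Longrightarrow> dist (k x) (k t) < e"
      using k(1)[unfolded continuous_at_eps_delta] e by blast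
    have "sqrt (W x) \<le> e * \<bar>x - t\<bar>" if x: "\<bar>x - t\<bar> < min d1 d2" for x
    proof (rule field_le_epsilon)
      fix h :: real assume h: "h > 0"
      \<comment> \<open>Adding \<open>h^2\<close> keeps the radicand positive, so \<open>w\<close>
        is differentiable along the whole segment with slope at most \<open>\<bar>k\<bar>\<close>.
        Since \<open>w t = h\<close>, this costs only the slack \<open>h\<close>.\<close>
      define w where "w = (\<lambda>x. sqrt (W x + h\<^sup>2))"
      let ?I = "closed_segment t x"
      have I: "y \<in> S" "\<bar>k y\<bar> \<le> e" if "y \<in> ?I" for y
      proof -
        have "\<bar>y - t\<bar> \<le> \<bar>x - t\<bar>" using that segment_bound(1)[OF that] by simp
        then have "dist y t < d1" "dist y t < d2" using x by (simp_all add: dist_real_def)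
        then show "y \<in> S" "\<bar>k y\<bar> \<le> e" using d1 d2(2)[of y] k(2) True
          by (auto simp: dist_commute subset_iff dist_real_def)
      qed
      have D: "(w has_real_derivative 2 * k y * sqrt (W y) / (2 * sqrt (W y + h\<^sup>2))) (at y within ?I)" if "y \<in> ?I" for y
      proof -
        have pos: "W y + h\<^sup>2 > 0" using nonneg[OF I(1)[OF that]] h by (simp add: add_nonneg_pos)
        have "((\<lambda>y. W y + h\<^sup>2) has_real_derivative 2 * k y * sqrt (W y)) (at y)"
          by (rule derivative_eq_intros W[OF I(1)[OF that]] refl)+ simp
        from DERIV_chain2[where f = sqrt and g = "\<lambda>y. W y + h\<^sup>2", OF DERIV_real_sqrt[OF pos] this]
        have "(w has_real_derivative 2 * k y * sqrt (W y) / (2 * sqrt (W y + h\<^sup>2))) (at y)"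
          unfolding w_def by (rule DERIV_cong) (simp add: inverse_eq_divide)
        then show ?thesis by (rule has_field_derivative_at_within)
      qed
      have "norm (w x - w t) \<le> e * norm (x - t)"
      proof (rule field_differentiable_bound[OF convex_closed_segment D])
        fix y assume y: "y \<in> ?I"
        have "sqrt (W y) \<le> sqrt (W y + h\<^sup>2)" by simp
        moreover have "0 < sqrt (W y + h\<^sup>2)" using nonneg[OF I(1)[OF y]] h by (simp add: add_nonneg_pos)
        ultimately have "sqrt (W y) / sqrt (W y + h\<^sup>2) \<le> 1" by simp
        then have "\<bar>k y\<bar> * (sqrt (W y) / sqrt (W y + h\<^sup>2)) \<le> e * 1"
          using I(2)[OF y] e nonneg[OF I(1)[OF y]] by (intro mult_mono) auto
        then show "norm (2 * k y * sqrt (W y) / (2 * sqrt (W y + h\<^sup>2))) \<le> e"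
          using nonneg[OF I(1)[OF y]] by (simp add: abs_mult)
      qed auto
      moreover have "w t = h" using True h by (simp add: w_def)
      moreover have "sqrt (W x) \<le> w x" by (simp add: w_def)
      ultimately show "sqrt (W x) \<le> e * \<bar>x - t\<bar> + h" by (simp add: abs_le_iff)
    qed
    moreover have "0 \<le> W x" if "\<bar>x - t\<bar> < min d1 d2" for x
      using nonneg[of x] that d1 by (auto simp: subset_iff dist_real_def abs_minus_commute)
    ultimately have "norm (sqrt (W x) - sqrt (W t) - 0 * (x - t)) \<le> e * norm (x - t)" if "norm (x - t) < min d1 d2" for x
      using that True by simp
    then show "\<exists>d>0. \<forall>x\<in>UNIV. norm (x - t) < d \<longrightarrow> norm (sqrt (W x) - sqrt (W t) - 0 * (x - t)) \<le> e * norm (x - t)"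
      using d1 d2 by (intro exI[of _ "min d1 d2"]) simp
  qed
  then show ?thesis using k(2)[OF True] by (simp add: has_field_derivative_def)
qed

section \<open>The functions \<open>T\<^sub>c\<close>\<close>

text \<open>The exponential extended by the value \<open>\<infinity>\<close> at
  \<open>\<infinity>\<close>: the monotone outer function of \<open>T\<close>, separated from the
  integral.\<close>

definition exp_ennreal :: "ennreal \<Rightarrow> ereal" where
  "exp_ennreal I = (if I = \<infinity> then \<infinity> else ereal (exp (enn2real I)))"

lemma exp_ennreal_ennreal [simp]: "0 \<le> a \<Longrightarrow> exp_ennreal (ennreal a) = ereal (exp a)"
  by (simp add: exp_ennreal_def)

lemma exp_ennreal_mono:
  assumes "I \<le> J" shows "exp_ennreal I \<le> exp_ennreal J"
proof (cases "J = \<infinity>")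
  case False
  then have "J < top" by (simp add: top.not_eq_extremum)
  moreover from this have "I < top" using assms by (rule order.strict_trans1[rotated])
  ultimately show ?thesis using assms enn2real_mono[of I J] by (auto simp: exp_ennreal_def)
qed (simp add: exp_ennreal_def)

lemma exp_ennreal_eq_iff: "R > 1 \<Longrightarrow> exp_ennreal I = ereal R \<longleftrightarrow> I = ennreal (ln R)"
  by (cases I) (auto simp: exp_ennreal_def)

lemma le_exp_ennreal_iff:
  assumes "R > 1" shows "ereal R \<le> exp_ennreal I \<longleftrightarrow> ennreal (ln R) \<le> I"
proof (cases I)
  case (real r)
  have "R \<le> exp r \<longleftrightarrow> ln R \<le> r"
    using assms exp_le_cancel_iff[of "ln R" r] by simp
  then show ?thesis using real by (simp add: ennreal_le_iff)
qed (simp add: exp_ennreal_def)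

section \<open>Data of a regular metric: \<open>m\<close>, \<open>q\<close>, \<open>g\<close> and
  the integral \<open>I\<close>\<close>

locale metric_on_annulus =
  fixes n :: nat and \<rho> :: "real \<Rightarrow> real" and Rs :: real
  assumes n: "3 \<le> n" and Rs: "1 < Rs" and regular: "regular_metric n Rs \<rho>"
begin

definition m :: "real \<Rightarrow> real" where "m y = y ^ n * \<rho> y"

text \<open>The value of \<open>(t H' / H)^2\<close> that the first integral prescribes where
  \<open>H = y\<close>.\<close>

definition q :: "real \<Rightarrow> real \<Rightarrow> real" where "q c y = Psi n (v n \<rho> c y)"

definition g :: "real \<Rightarrow> real \<Rightarrow> real" where "g c y = y * sqrt (q c y)"

definition I :: "real \<Rightarrow> real \<Rightarrow> ennreal" where
  "I c s = (\<integral>\<^sup>+y\<in>{1..s}. inverse (ennreal (g c y)) \<partial>lborel)"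

lemma T_eq: "T n \<rho> c s = exp_ennreal (I c s)"
  by (simp add: T_def I_def g_def q_def exp_ennreal_def)

lemma v_eq: "v n \<rho> c y = c / m y"
  by (simp add: v_def m_def)

lemma \<rho>_pos: "y \<in> {1..Rs} \<Longrightarrow> 0 < \<rho> y"
  using regular by (simp add: regular_metric_def)

lemma m_1 [simp]: "m 1 = \<rho> 1" by (simp add: m_def)

lemma m_pos: "y \<in> {1..Rs} \<Longrightarrow> 0 < m y"
  using \<rho>_pos[of y] by (simp add: m_def)

lemma m_ge:
  assumes "y \<in> {1..Rs}" shows "\<rho> 1 \<le> m y"
proof -
  have "bdd_below ((\<lambda>s. \<rho> s * s ^ n) ` {1..Rs})"
    by (rule bdd_belowI[of _ 0]) (use \<rho>_pos in \<open>force simp: less_imp_le\<close>)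
  then have "(INF s\<in>{1..Rs}. \<rho> s * s ^ n) \<le> \<rho> y * y ^ n"
    using assms by (rule cINF_lower)
  then show ?thesis using regular by (simp add: regular_metric_def m_def mult.commute)
qed

lemma m_has_derivative:
  obtains m' where "continuous_on {1..Rs} m'"
    "\<And>y. y \<in> {1..Rs} \<Longrightarrow> (m has_real_derivative m' y) (at y within {1..Rs})"
proof -
  obtain \<rho>' where c: "continuous_on {1..Rs} \<rho>'"
    and d: "\<And>y. y \<in> {1..Rs} \<Longrightarrow> (\<rho> has_real_derivative \<rho>' y) (at y within {1..Rs})"
    using regular unfolding regular_metric_def by blast
  have "continuous_on {1..Rs} \<rho>" using d by (rule DERIV_continuous_on)
  then have "continuous_on {1..Rs} (\<lambda>y. y ^ n * \<rho>' y + real n * y ^ (n - 1) * \<rho> y)"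
    by (intro continuous_intros c)
  moreover have "(m has_real_derivative y ^ n * \<rho>' y + real n * y ^ (n - 1) * \<rho> y) (at y within {1..Rs})"
    if "y \<in> {1..Rs}" for y
    unfolding m_def[abs_def] by (rule derivative_eq_intros d[OF that] refl)+ simp
  ultimately show thesis using that by blast
qed

lemma continuous_m: "continuous_on {1..Rs} m"
  using m_has_derivative by (metis DERIV_continuous_on)

lemma c_div_m_less_1: "c < m y \<Longrightarrow> y \<in> {1..Rs} \<Longrightarrow> c / m y < 1"
  using m_pos[of y] by simp

lemma c_div_m_le_1:
  assumes "c \<le> \<rho> 1" "y \<in> {1..Rs}" shows "c / m y \<le> 1"
  using m_pos[OF assms(2)] m_ge[OF assms(2)] assms(1) by simp

lemma q_nonneg: "c \<le> \<rho> 1 \<Longrightarrow> y \<in> {1..Rs} \<Longrightarrow> 0 \<le> q c y"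
  unfolding q_def v_eq by (rule Psi_nonneg[OF n c_div_m_le_1])

lemma q_pos: "c < m y \<Longrightarrow> y \<in> {1..Rs} \<Longrightarrow> 0 < q c y"
  unfolding q_def v_eq by (rule Psi_pos[OF n c_div_m_less_1])

lemma q_antimono:
  assumes "c \<le> c'" "c' \<le> \<rho> 1" "y \<in> {1..Rs}" shows "q c' y \<le> q c y"
  unfolding q_def v_eq
proof (rule Psi_antimono[OF n _ c_div_m_le_1])
  show "c / m y \<le> c' / m y" using assms m_pos[of y] by (simp add: divide_right_mono)
qed (use assms in auto)

text \<open>\<open>Psi\<close> is continuous up to the end point 1 of its domain, so joint
  continuity includes the critical parameter. Fixing \<open>c\<close> gives a continuous right-hand
  side of the equation for \<open>H\<close>; fixing \<open>y\<close> gives the limit at the critical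
  parameter.\<close>

lemma continuous_q2:
  "continuous_on ({..\<rho> 1} \<times> {1..Rs}) (\<lambda>(c, y). q c y)"
  unfolding q_def v_eq split_def
proof (rule continuous_on_compose2[OF continuous_on_Psi[OF n]])
  show "continuous_on ({..\<rho> 1} \<times> {1..Rs}) (\<lambda>p. fst p / m (snd p))"
    using m_pos
    by (intro continuous_intros continuous_on_compose2[OF continuous_m]) (auto simp: less_imp_neq[symmetric])
qed (use c_div_m_le_1 in auto)

lemma continuous_q: "c \<le> \<rho> 1 \<Longrightarrow> continuous_on {1..Rs} (q c)"
  using continuous_on_compose2[OF continuous_q2 continuous_on_Pair[OF continuous_on_const continuous_on_id],
      of c "{1..Rs}"] by auto

lemma continuous_g: "c \<le> \<rho> 1 \<Longrightarrow> continuous_on {1..Rs} (g c)"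
  unfolding g_def by (intro continuous_intros continuous_q)

lemma g_nonneg: "c \<le> \<rho> 1 \<Longrightarrow> y \<in> {1..Rs} \<Longrightarrow> 0 \<le> g c y"
  using q_nonneg by (simp add: g_def)

lemma g_pos: "c < m y \<Longrightarrow> y \<in> {1..Rs} \<Longrightarrow> 0 < g c y"
  using q_pos by (simp add: g_def)

lemma g_antimono: "c \<le> c' \<Longrightarrow> c' \<le> \<rho> 1 \<Longrightarrow> y \<in> {1..Rs} \<Longrightarrow> g c' y \<le> g c y"
  unfolding g_def using q_antimono by (intro mult_left_mono) auto

lemma integrand_mono:
  assumes "c \<le> c'" "c' \<le> \<rho> 1" "y \<in> {1..Rs}"
  shows "inverse (ennreal (g c y)) \<le> inverse (ennreal (g c' y))"
\<comment> \<open>If \<open>g c' y = 0\<close>, the right-hand side is \<open>\<infinity>\<close>;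
  otherwise both values are positive and the real inequality inverts.\<close>
proof (cases "g c' y = 0")
  case False
  then have "0 < g c' y" using g_nonneg assms by (simp add: order_less_le)
  moreover from this have "0 < g c y" using g_antimono[OF assms] by linarith
  ultimately show ?thesis
    using g_antimono[OF assms] by (simp add: inverse_ennreal ennreal_leI)
qed simp

lemma measurable_g:
  assumes "c \<le> \<rho> 1" "s \<le> Rs"
  shows "(\<lambda>y. indicator {1..s} y * g c y) \<in> borel_measurable borel"
  using borel_measurable_continuous_on_indicator[of "{1..s}" "g c"]
    continuous_on_subset[OF continuous_g[OF assms(1)], of "{1..s}"] assms(2) by simp

lemma measurable_integrand:
  assumes "c \<le> \<rho> 1" "s \<le> Rs"
  shows "(\<lambda>y. inverse (ennreal (g c y)) * indicator {1..s} y) \<in> borel_measurable lborel"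
proof -
  \<comment> \<open>Measurability of \<open>g c\<close> is available only after cutting off to the
    interval, so the indicator is copied inside the reciprocal.\<close>
  have "(\<lambda>y. inverse (ennreal (g c y)) * indicator {1..s} y)
      = (\<lambda>y. inverse (ennreal (indicator {1..s} y * g c y)) * indicator {1..s} y)"
    by (auto simp: indicator_def)
  also have "\<dots> \<in> borel_measurable lborel"
    using measurable_g[OF assms] by measurable
  finally show ?thesis .
qed

lemma I_mono_c: "c \<le> c' \<Longrightarrow> c' \<le> \<rho> 1 \<Longrightarrow> s \<le> Rs \<Longrightarrow> I c s \<le> I c' s"
  unfolding I_def using integrand_mono by (intro nn_integral_mono) (auto simp: indicator_def)

lemma I_mono_s: "s \<le> s' \<Longrightarrow> I c s \<le> I c s'"
  unfolding I_def by (intro nn_integral_mono) (auto simp: indicator_def)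

lemma T_mono_c: "c \<le> c' \<Longrightarrow> c' \<le> \<rho> 1 \<Longrightarrow> s \<le> Rs \<Longrightarrow> T n \<rho> c s \<le> T n \<rho> c' s"
  unfolding T_eq by (intro exp_ennreal_mono I_mono_c)

lemma T_mono_s: "s \<le> s' \<Longrightarrow> T n \<rho> c s \<le> T n \<rho> c s'"
  unfolding T_eq by (intro exp_ennreal_mono I_mono_s)

text \<open>The reciprocals in \<open>ennreal\<close> and in the reals differ where
  \<open>g c\<close> vanishes (\<open>\<infinity>\<close> against 0); on a null set this does not
  affect the integrals.\<close>

lemma I_eq_integral:
  assumes c: "c \<le> \<rho> 1" and s: "s \<le> Rs"
    and J: "((\<lambda>y. inverse (g c y)) has_integral J) {1..s}"
    and ae: "AE y in lborel. y \<in> {1..s} \<longrightarrow> g c y \<noteq> 0"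
  shows "I c s = ennreal J" and "0 \<le> J"
proof -
  have nn: "0 \<le> inverse (g c y)" if "y \<in> {1..s}" for y
    using g_nonneg[OF c, of y] that s by simp
  have "I c s = (\<integral>\<^sup>+y. ennreal (indicator {1..s} y * inverse (g c y)) \<partial>lborel)"
    unfolding I_def
  proof (rule nn_integral_cong_AE, rule eventually_mono[OF ae])
    fix y assume "y \<in> {1..s} \<longrightarrow> g c y \<noteq> 0"
    then have "y \<in> {1..s} \<Longrightarrow> 0 < g c y" using g_nonneg[OF c, of y] s by force
    then show "inverse (ennreal (g c y)) * indicator {1..s} y = ennreal (indicator {1..s} y * inverse (g c y))"
      by (cases "y \<in> {1..s}") (simp_all add: inverse_ennreal)
  qed
  also have "\<dots> = ennreal J" using nn_integral_has_integral_lebesgue[OF nn J] by simp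
  finally show "I c s = ennreal J" .
  show "0 \<le> J" using has_integral_nonneg[OF J] nn by blast
qed

text \<open>A finite integral allows the integrand to be \<open>\<infinity>\<close> only on a null
  set. Hence the zeros of \<open>g c\<close> are negligible, even in the critical case.\<close>

lemma reciprocal_integral_g:
  assumes c: "c \<le> \<rho> 1" and fin: "I c Rs < \<infinity>"
  shows "reciprocal_integral 1 Rs (g c) (\<lambda>y. inverse (g c y))"
    and "AE y in lborel. y \<in> {1..Rs} \<longrightarrow> g c y \<noteq> 0"
proof -
  have "AE y in lborel. inverse (ennreal (g c y)) * indicator {1..Rs} y \<noteq> \<infinity>"
    using measurable_integrand[OF c] fin unfolding I_def by (intro nn_integral_PInf_AE) auto
  then show ae: "AE y in lborel. y \<in> {1..Rs} \<longrightarrow> g c y \<noteq> 0"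
    by (rule eventually_mono) auto
  then obtain N where N: "N \<in> null_sets lborel" "{y. \<not> (y \<in> {1..Rs} \<longrightarrow> g c y \<noteq> 0)} \<subseteq> N"
    unfolding eventually_ae_filter by auto
  have "negligible N"
    using N(1) by (simp add: negligible_iff_null_sets null_sets_completionI)
  then have neg: "negligible {y \<in> {1..Rs}. g c y * inverse (g c y) \<noteq> 1}"
  proof (rule negligible_subset)
    have "x \<in> N" if "x \<in> {1..Rs}" "g c x * inverse (g c x) \<noteq> 1" for x
    proof -
      have "g c x = 0" using that(2) right_inverse by blast
      then show ?thesis using that(1) N(2) by auto
    qed
    then show "{y \<in> {1..Rs}. g c y * inverse (g c y) \<noteq> 1} \<subseteq> N" by blast
  qed
  let ?f = "\<lambda>y. indicator {1..Rs} y * inverse (g c y)"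
  have eq: "?f = (\<lambda>y. inverse (indicator {1..Rs} y * g c y))" by (auto simp: indicator_def)
  have "?f \<in> borel_measurable borel"
    unfolding eq using measurable_g[OF c order_refl] by measurable
  moreover have nn: "0 \<le> ?f y" for y
    using g_nonneg[OF c] by (auto simp: indicator_def)
  moreover have "(\<integral>\<^sup>+y. ennreal (?f y) \<partial>lborel) = I c Rs"
    unfolding I_def
  proof (rule nn_integral_cong_AE, rule eventually_mono[OF ae])
    fix y assume "y \<in> {1..Rs} \<longrightarrow> g c y \<noteq> 0"
    then have "y \<in> {1..Rs} \<Longrightarrow> 0 < g c y" using g_nonneg[OF c, of y] by force
    then show "ennreal (?f y) = inverse (ennreal (g c y)) * indicator {1..Rs} y"
      by (cases "y \<in> {1..Rs}") (simp_all add: inverse_ennreal)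
  qed
  ultimately have "?f integrable_on UNIV" using fin by (intro nn_integral_integrable_on) auto
  moreover have "?f = (\<lambda>y. if y \<in> {1..Rs} then inverse (g c y) else 0)" by (auto simp: indicator_def)
  ultimately have "(\<lambda>y. inverse (g c y)) integrable_on {1..Rs}"
    using integrable_restrict_UNIV[of "{1..Rs}" "\<lambda>y. inverse (g c y)"] by simp
  then show "reciprocal_integral 1 Rs (g c) (\<lambda>y. inverse (g c y))"
    using Rs continuous_g[OF c] g_nonneg[OF c] neg by unfold_locales auto
qed

section \<open>Dependence on the parameter and attainment of the radius\<close>

lemma I_subcritical:
  assumes "c < \<rho> 1" shows "I c Rs = ennreal (integral {1..Rs} (\<lambda>y. inverse (g c y)))"
proof (rule I_eq_integral)
  have pos: "0 < g c y" if "y \<in> {1..Rs}" for y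
    using g_pos[of c y] m_ge[OF that] assms that by simp
  have "continuous_on {1..Rs} (\<lambda>y. inverse (g c y))"
    using pos assms by (intro continuous_intros continuous_g) (auto simp: less_imp_neq[symmetric])
  then show "((\<lambda>y. inverse (g c y)) has_integral integral {1..Rs} (\<lambda>y. inverse (g c y))) {1..Rs}"
    by (intro integrable_integral integrable_continuous_real)
  show "AE y in lborel. y \<in> {1..Rs} \<longrightarrow> g c y \<noteq> 0"
    using pos by (intro AE_I2) force
qed (use assms in auto)

text \<open>For \<open>c < \<rho> 1\<close> the denominator has no zeros, so the integrand is
  jointly continuous. The critical value is approached by \<open>I_tendsto_critical\<close>
  instead.\<close>

lemma continuous_integral_subcritical:
  "continuous_on {..<\<rho> 1} (\<lambda>c. integral {1..Rs} (\<lambda>y. inverse (g c y)))"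
proof -
  have "continuous_on ({..<\<rho> 1} \<times> {1..Rs}) (\<lambda>(c, y). q c y)"
    by (rule continuous_on_subset[OF continuous_q2]) auto
  moreover have "0 < q c y" if "c < \<rho> 1" "y \<in> {1..Rs}" for c y
    using q_pos[of c y] m_ge[of y] that by simp
  ultimately have "continuous_on ({..<\<rho> 1} \<times> cbox 1 Rs) (\<lambda>(c, y). inverse (g c y))"
    unfolding g_def split_def by (intro continuous_intros) force+
  from integral_continuous_on_param[OF this] show ?thesis by simp
qed

text \<open>For very negative \<open>c\<close> the function \<open>g c\<close> is uniformly large,
  which makes the integral of its reciprocal small.\<close>

lemma I_small:
  assumes "R > 1" obtains c where "c < \<rho> 1" "I c Rs \<le> ennreal (ln R)"
proof -
  obtain M where M: "\<And>y. y \<in> {1..Rs} \<Longrightarrow> m y \<le> M" "0 < M"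
  proof -
    have "\<exists>y\<in>{1..Rs}. \<forall>z\<in>{1..Rs}. m z \<le> m y"
      using Rs by (intro continuous_attains_sup continuous_m) auto
    then show thesis using that m_pos by blast
  qed
  \<comment> \<open>\<open>K\<close> is chosen with \<open>sqrt K = (Rs - 1) / ln R\<close>: once
    \<open>g c\<close> is at least this, integrating its reciprocal over length
    \<open>Rs - 1\<close> gives at most \<open>ln R\<close>. The next choice makes
    \<open>c / M = - \<bar>Phi n K\<bar>\<close>, and as \<open>c\<close> is nonpositive this bounds
    every \<open>c / m y\<close> from above.\<close>
  define K where "K = ((Rs - 1) / ln R)\<^sup>2"
  define c where "c = - \<bar>Phi n K\<bar> * M"
  have c0: "c \<le> 0" using M by (simp add: c_def)
  then have c: "c < \<rho> 1" using \<rho>_pos[of 1] Rs by simp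
  have K: "0 \<le> K" by (simp add: K_def)
  have lnR: "0 < ln R" using assms by simp
  have g: "(Rs - 1) / ln R \<le> g c y" if y: "y \<in> {1..Rs}" for y
  proof -
    have "c / m y \<le> c / M" using c0 M(1)[OF y] m_pos[OF y] by (simp add: divide_left_mono_neg)
    also have "c / M \<le> Phi n K" using M(2) by (simp add: c_def)
    finally have "c / m y \<le> Phi n K" .
    moreover have "Phi n K \<le> 1"
      using Phi_strict_antimono[OF n, of 0 K] K by (cases "K = 0") auto
    ultimately have "K \<le> q c y"
      using Psi_antimono[OF n, of "c / m y" "Phi n K"] Psi_Phi[OF n K] by (simp add: q_def v_eq)
    then have "sqrt K \<le> sqrt (q c y)" by simp
    moreover have "sqrt K = (Rs - 1) / ln R" using Rs lnR by (simp add: K_def)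
    moreover have "sqrt (q c y) \<le> g c y"
      using y q_nonneg[of c y] c mult_right_mono[of 1 y "sqrt (q c y)"] by (simp add: g_def)
    ultimately show ?thesis by linarith
  qed
  have "I c Rs \<le> (\<integral>\<^sup>+y. ennreal (ln R / (Rs - 1)) * indicator {1..Rs} y \<partial>lborel)"
    unfolding I_def
  proof (rule nn_integral_mono)
    fix y
    show "inverse (ennreal (g c y)) * indicator {1..Rs} y \<le> ennreal (ln R / (Rs - 1)) * indicator {1..Rs} y"
    proof (cases "y \<in> {1..Rs}")
      case True
      have p: "0 < (Rs - 1) / ln R" using Rs lnR by simp
      have "inverse (g c y) \<le> inverse ((Rs - 1) / ln R)"
        using g[OF True] p by (rule le_imp_inverse_le)
      moreover have "0 < g c y" using g[OF True] p by linarith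
      ultimately show ?thesis using True by (simp add: inverse_ennreal ennreal_leI)
    qed simp
  qed
  also have "\<dots> = ennreal (ln R)"
    using Rs lnR by (simp add: nn_integral_cmult_indicator flip: ennreal_mult)
  finally show thesis using that c by blast
qed

text \<open>Monotone convergence: the integrands increase with the parameter. Continuity of the
  reciprocal in \<open>ennreal\<close> covers the points where the critical \<open>g\<close>
  vanishes, and the limit may be infinite.\<close>

lemma I_tendsto_critical: "(\<lambda>k. I (\<rho> 1 - 1 / real (Suc k)) Rs) \<longlonglongrightarrow> I (\<rho> 1) Rs"
proof -
  let ?c = "\<lambda>k. \<rho> 1 - 1 / real (Suc k)"
  have le: "?c k \<le> \<rho> 1" for k by simp
  show ?thesis
    unfolding I_def
  proof (rule nn_integral_LIMSEQ)
    show "incseq (\<lambda>k y. inverse (ennreal (g (?c k) y)) * indicator {1..Rs} y)"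
    proof (rule incseq_SucI, rule le_funI)
      fix k y
      have "?c k \<le> ?c (Suc k)" by (simp add: frac_le)
      then show "inverse (ennreal (g (?c k) y)) * indicator {1..Rs} y
          \<le> inverse (ennreal (g (?c (Suc k)) y)) * indicator {1..Rs} y"
        using integrand_mono[OF _ le, of "?c k" "Suc k" y] by (auto simp: indicator_def)
    qed
    show "(\<lambda>y. inverse (ennreal (g (?c k) y)) * indicator {1..Rs} y) \<in> borel_measurable lborel" for k
      by (rule measurable_integrand[OF le order_refl])
    show "(\<lambda>k. inverse (ennreal (g (?c k) y)) * indicator {1..Rs} y)
        \<longlonglongrightarrow> inverse (ennreal (g (\<rho> 1) y)) * indicator {1..Rs} y" for y
    proof (cases "y \<in> {1..Rs}")
      case True
      have "continuous_on {..\<rho> 1} (\<lambda>c. q c y)"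
        using continuous_on_compose2[OF continuous_q2 continuous_on_Pair[OF continuous_on_id continuous_on_const],
            of y "{..\<rho> 1}"] True by (simp add: image_subset_iff)
      then have "continuous_on {..\<rho> 1} (\<lambda>c. inverse (ennreal (g c y)))"
        unfolding g_def by (intro continuous_on_inverse_ennreal continuous_on_ennreal continuous_intros)
      moreover have "?c \<longlonglongrightarrow> \<rho> 1"
        using tendsto_diff[OF tendsto_const LIMSEQ_inverse_real_of_nat] by (simp add: inverse_eq_divide)
      ultimately have "(\<lambda>k. inverse (ennreal (g (?c k) y))) \<longlonglongrightarrow> inverse (ennreal (g (\<rho> 1) y))"
        by (rule continuous_on_tendsto_compose) (use le in \<open>auto intro!: always_eventually\<close>)
      then show ?thesis using True by simp
    qed simp
  qed
qed

lemma exists_parameter: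
  assumes R: "R > 1" and le: "ereal R \<le> T n \<rho> (\<rho> 1) Rs"
  obtains c where "c \<le> \<rho> 1" "T n \<rho> c Rs = ereal R"
\<comment> \<open>Either the critical parameter itself attains \<open>R\<close>, or the target is
  strictly below the critical value. Then \<open>I_tendsto_critical\<close> and
  \<open>I_small\<close> give subcritical parameters on both sides, and the intermediate value
  theorem applies.\<close>
proof (cases "I (\<rho> 1) Rs = ennreal (ln R)")
  case True
  then show thesis using that[of "\<rho> 1"] R by (simp add: T_eq exp_ennreal_eq_iff)
next
  case False
  let ?J = "\<lambda>c. integral {1..Rs} (\<lambda>y. inverse (g c y))"
  have "ennreal (ln R) < I (\<rho> 1) Rs"
    using le False R by (simp add: T_eq le_exp_ennreal_iff)
  from eventually_happens'[OF _ order_tendstoD(1)[OF I_tendsto_critical this]]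
  obtain k where k: "ennreal (ln R) < I (\<rho> 1 - 1 / real (Suc k)) Rs" by auto
  define c2 where "c2 = \<rho> 1 - 1 / real (Suc k)"
  have c2: "c2 < \<rho> 1" "ennreal (ln R) < I c2 Rs" using k by (simp_all add: c2_def)
  obtain c1 where c1: "c1 < \<rho> 1" "I c1 Rs \<le> ennreal (ln R)" using I_small[OF R] .
  have "c1 \<le> c2" using I_mono_c[of c2 c1 Rs] c1 c2 by (meson less_le_not_le linear order_trans order_refl)
  moreover have "?J c1 \<le> ln R" "ln R \<le> ?J c2"
    using c1 c2 R unfolding I_subcritical[OF c1(1)] I_subcritical[OF c2(1)]
    by (simp_all add: ennreal_le_iff ennreal_less_iff)
  moreover have "continuous_on {c1..c2} ?J"
    by (rule continuous_on_subset[OF continuous_integral_subcritical]) (use c2 in auto)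
  ultimately obtain c where c: "c1 \<le> c" "c \<le> c2" "?J c = ln R"
    using IVT'[of ?J c1 "ln R" c2] by auto
  then have "c < \<rho> 1" using c2 by simp
  then show thesis using that[of c] c R by (simp add: T_eq exp_ennreal_eq_iff I_subcritical)
qed

end

section \<open>The maps \<open>H\<^sub>c\<close>\<close>

context metric_on_annulus
begin

lemma at_within_interval: "y \<in> {1<..<Rs} \<Longrightarrow> at y within {1..Rs} = at y"
  by (rule at_within_interior) (simp add: interior_atLeastAtMost_real)

lemma q_has_derivative:
  assumes c: "c \<le> \<rho> 1"
  obtains q' where "continuous_on {1..Rs} q'"
    "\<And>y. y \<in> {1..Rs} \<Longrightarrow> (q c has_real_derivative q' y) (at y within {1..Rs})"
proof -
  obtain m' where cm': "continuous_on {1..Rs} m'"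
    and m': "\<And>y. y \<in> {1..Rs} \<Longrightarrow> (m has_real_derivative m' y) (at y within {1..Rs})"
    using m_has_derivative by blast
  define q' where "q' = (\<lambda>y. inverse (dPhi n (q c y)) * (- (c * m' y) / (m y * m y)))"
  have m0: "m y \<noteq> 0" if "y \<in> {1..Rs}" for y using m_pos[OF that] by simp
  have neg: "dPhi n (q c y) \<noteq> 0" if "y \<in> {1..Rs}" for y
    using dPhi_neg[OF n, of "q c y"] q_nonneg[OF c that] by simp
  have "continuous_on {1..Rs} (\<lambda>y. dPhi n (q c y))"
    by (rule continuous_on_compose2[OF continuous_on_dPhi[OF n] continuous_q[OF c]])
      (use q_nonneg[OF c] in \<open>force simp: image_subset_iff\<close>)
  then have "continuous_on {1..Rs} q'"
    unfolding q'_def using m0 neg by (intro continuous_intros cm' continuous_m) auto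
  moreover have "(q c has_real_derivative q' y) (at y within {1..Rs})" if y: "y \<in> {1..Rs}" for y
  proof -
    have "((\<lambda>y. c / m y) has_real_derivative - (c * m' y) / (m y * m y)) (at y within {1..Rs})"
      using DERIV_divide[OF DERIV_const m'[OF y] m0[OF y]] by simp
    moreover have "(Psi n has_real_derivative inverse (dPhi n (q c y))) (at (c / m y) within (\<lambda>y. c / m y) ` {1..Rs})"
      unfolding q_def v_eq
      by (rule DERIV_subset[OF Psi_has_derivative[OF n c_div_m_le_1[OF c y]]])
        (use c_div_m_le_1[OF c] in auto)
    ultimately have "((\<lambda>y. Psi n (c / m y)) has_real_derivative q' y) (at y within {1..Rs})"
      unfolding q'_def by (rule DERIV_image_chain[unfolded o_def, rotated])
    then show ?thesis by (simp add: q_def[abs_def] v_eq)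
  qed
  ultimately show thesis using that by blast
qed

text \<open>Since \<open>q c\<close> is nonnegative, a zero in the interior is a local minimum. This
  supplies the condition of \<open>DERIV_sqrt_of_ode\<close> at zeros of \<open>W\<close>.\<close>

lemma q_derivative_zero:
  assumes c: "c \<le> \<rho> 1" and y: "y \<in> {1<..<Rs}" "q c y = 0"
    and d: "(q c has_real_derivative d) (at y)"
  shows "d = 0"
proof (rule DERIV_local_min[OF d, of "min (y - 1) (Rs - y)"])
  show "\<forall>z. \<bar>y - z\<bar> < min (y - 1) (Rs - y) \<longrightarrow> q c y \<le> q c z"
    using q_nonneg[OF c] y(2) by (auto simp: abs_less_iff)
qed (use y in auto)

lemma T_eq_exp_integral:
  assumes c: "c \<le> \<rho> 1" and s: "s \<le> Rs"
    and J: "((\<lambda>y. inverse (g c y)) has_integral J) {1..s}"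
    and ae: "AE y in lborel. y \<in> {1..s} \<longrightarrow> g c y \<noteq> 0"
  shows "T n \<rho> c s = ereal (exp J)"
  using I_eq_integral[OF assms] by (simp add: T_eq)

end

text \<open>Covers every parameter \<open>c \<le> \<rho> 1\<close>, critical or subcritical, whose
  \<open>T\<close> takes the value \<open>R\<close> at \<open>Rs\<close>.\<close>

locale critical_radius = metric_on_annulus +
  fixes R c :: real
  assumes R: "1 < R" and c: "c \<le> \<rho> 1" and T_Rs: "T n \<rho> c Rs = ereal R"
begin

lemma I_Rs: "I c Rs = ennreal (ln R)"
  using T_Rs R by (simp add: T_eq exp_ennreal_eq_iff)

sublocale reciprocal_integral 1 Rs "g c" "\<lambda>y. inverse (g c y)"
  using reciprocal_integral_g(1)[OF c] by (simp add: I_Rs)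

lemma T_eq_exp_L:
  assumes "s \<in> {1..Rs}" shows "T n \<rho> c s = ereal (exp (L s))"
proof (rule T_eq_exp_integral[OF c])
  show "((\<lambda>y. inverse (g c y)) has_integral L s) {1..s}"
    using has_integral_f[of 1 s] assms by simp
  show "AE y in lborel. y \<in> {1..s} \<longrightarrow> g c y \<noteq> 0"
    using reciprocal_integral_g(2)[OF c] assms by (auto simp: I_Rs elim: eventually_mono)
qed (use assms in auto)

lemma L_Rs [simp]: "L Rs = ln R"
  using T_eq_exp_L[of Rs] T_Rs Rs by (simp add: ln_unique)

abbreviation H :: "real \<Rightarrow> real" where "H \<equiv> H_inv n \<rho> Rs c"

lemma H_eq:
  assumes "t > 0" shows "H t = G (ln t)"
proof -
  \<comment> \<open>The predicates defining the two inverses coincide for every \<open>y\<close>, so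
    the equality holds for all positive \<open>t\<close>, including those outside the range.\<close>
  have "(y \<in> {1..Rs} \<and> T n \<rho> c y = ereal t) \<longleftrightarrow> (y \<in> {1..Rs} \<and> L y = ln t)" for y
    using assms by (cases "y \<in> {1..Rs}") (auto simp: T_eq_exp_L ln_unique)
  then show ?thesis by (simp add: H_inv_def G_def the_inv_into_def)
qed

lemma H_interior: "t \<in> {1<..<R} \<Longrightarrow> H t \<in> {1<..<Rs}"
  using G_interior[of "ln t"] by (simp add: H_eq)

lemma H_exp_L: "s \<in> {1<..<Rs} \<Longrightarrow> exp (L s) \<in> {1<..<R} \<and> H (exp (L s)) = s"
  using L_interior[of s] G_L[of s] R by (simp add: H_eq flip: ln_less_cancel_iff[of _ R])

lemma H_strict_mono: "strict_mono_on {1<..<R} H"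
  by (rule strict_mono_onI) (simp add: H_eq G_less_iff)

lemma H_bij: "bij_betw H {1<..<R} {1<..<Rs}"
  unfolding bij_betw_def
proof
  show "inj_on H {1<..<R}" by (rule strict_mono_on_imp_inj_on[OF H_strict_mono])
  show "H ` {1<..<R} = {1<..<Rs}"
  proof
    show "H ` {1<..<R} \<subseteq> {1<..<Rs}" using H_interior by blast
    show "{1<..<Rs} \<subseteq> H ` {1<..<R}" using H_exp_L by (metis image_eqI subsetI)
  qed
qed

definition H' :: "real \<Rightarrow> real" where "H' t = H t * sqrt (q c (H t)) / t"

lemma H_has_derivative:
  assumes "t \<in> {1<..<R}" shows "(H has_real_derivative H' t) (at t)"
proof -
  have "(G has_real_derivative g c (G (ln t))) (at (ln t))"
    by (rule G_has_derivative) (use assms in simp)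
  from DERIV_chain2[OF this DERIV_ln] assms
  have "((\<lambda>t. G (ln t)) has_real_derivative H' t) (at t)"
    by (simp add: H'_def H_eq g_def divide_inverse)
  then show ?thesis
    by (rule has_field_derivative_transform_within_open[of _ _ _ "{0<..}"]) (use assms H_eq in auto)
qed

lemma continuous_H: "continuous_on {1<..<R} H"
  using H_has_derivative by (meson DERIV_isCont continuous_at_imp_continuous_on)

lemma C2_H: "C2_on {1<..<R} H"
proof -
  obtain q' where cq': "continuous_on {1..Rs} q'"
    and q': "\<And>y. y \<in> {1..Rs} \<Longrightarrow> (q c has_real_derivative q' y) (at y within {1..Rs})"
    using q_has_derivative[OF c] by blast
  define u where "u = (\<lambda>t. sqrt (q c (H t)))"
  \<comment> \<open>With \<open>W = q c (H t)\<close>, the chain rule and the equation for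
    \<open>H'\<close> give \<open>W' = 2 k sqrt W\<close>. Hence \<open>u = sqrt W\<close> is
    continuously differentiable across zeros of \<open>W\<close>, and so is
    \<open>H' = H u / t\<close>.\<close>
  define k where "k = (\<lambda>t. q' (H t) * H t / (2 * t))"
  have HI: "H t \<in> {1..Rs}" if "t \<in> {1<..<R}" for t using H_interior[OF that] by simp
  have Himg: "H ` {1<..<R} \<subseteq> {1..Rs}" using HI by blast
  have d: "(q c has_real_derivative q' (H t)) (at (H t))" if "t \<in> {1<..<R}" for t
    using q'[OF HI[OF that]] at_within_interval[OF H_interior[OF that]] by simp
  have ck: "continuous_on {1<..<R} k"
    unfolding k_def by (intro continuous_intros continuous_on_compose2[OF cq' continuous_H] continuous_H Himg) auto
  have du: "(u has_real_derivative k t) (at t)" if t: "t \<in> {1<..<R}" for t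
    unfolding u_def
  proof (rule DERIV_sqrt_of_ode[OF open_greaterThanLessThan t])
    show "((\<lambda>t. q c (H t)) has_real_derivative 2 * k x * sqrt (q c (H x))) (at x)" if "x \<in> {1<..<R}" for x
      using DERIV_chain2[OF d[OF that] H_has_derivative[OF that]] that by (simp add: k_def H'_def mult.assoc)
    show "isCont k t" using ck t by (simp add: continuous_on_eq_continuous_at)
    show "0 \<le> q c (H x)" if "x \<in> {1<..<R}" for x using q_nonneg[OF c HI[OF that]] .
    show "q c (H t) = 0 \<Longrightarrow> k t = 0"
      using q_derivative_zero[OF c H_interior[OF t] _ d[OF t]] by (simp add: k_def)
  qed
  then have cu: "continuous_on {1<..<R} u"
    by (meson DERIV_isCont continuous_at_imp_continuous_on)
  define H'' where "H'' = (\<lambda>t. ((H' t * u t + H t * k t) * t - H t * u t) / (t * t))"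
  have H'_eq: "H' = (\<lambda>t. H t * u t / t)" by (simp add: H'_def[abs_def] u_def)
  have "(H' has_real_derivative H'' t) (at t)" if t: "t \<in> {1<..<R}" for t
    unfolding H'_eq H''_def
    by (rule derivative_eq_intros H_has_derivative[OF t] du[OF t] refl)+ (use t in \<open>auto simp: H'_eq algebra_simps\<close>)
  moreover have "continuous_on {1<..<R} H''"
    unfolding H''_def H'_eq by (intro continuous_intros continuous_H cu ck) auto
  ultimately show ?thesis using H_has_derivative unfolding C2_on_def by blast
qed

lemma homeo: "increasing_C2_homeo R Rs H"
  unfolding increasing_C2_homeo_def using H_strict_mono H_bij C2_H by blast

lemma first_integral:
  assumes "t \<in> {1<..<R}" shows "\<rho> (H t) * H t ^ n * Phi n ((t * H' t / H t)\<^sup>2) = c"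
proof -
  have y: "H t \<in> {1..Rs}" "H t > 0" using H_interior[OF assms] by auto
  have "(t * H' t / H t)\<^sup>2 = q c (H t)"
    using assms y q_nonneg[OF c y(1)] by (simp add: H'_def)
  moreover have "Phi n (q c (H t)) = c / m (H t)"
    unfolding q_def v_eq by (rule Phi_Psi[OF n c_div_m_le_1[OF c y(1)]])
  moreover have "\<rho> (H t) * H t ^ n = m (H t)" by (simp add: m_def mult.commute)
  ultimately show ?thesis using m_pos[OF y(1)] by simp
qed

text \<open>The inverse of \<open>H\<close> is \<open>exp (L s)\<close>, with derivative
  \<open>exp (L s) / g c s\<close>; positivity of \<open>g c\<close> in the open interval makes it
  twice continuously differentiable. The point 1, where \<open>g c\<close> vanishes if
  \<open>c = \<rho> 1\<close>, is excluded.\<close>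

lemma diffeo:
  assumes noncritical: "\<And>s. s \<in> {1<..<Rs} \<Longrightarrow> c < m s"
  shows "increasing_C2_diffeo R Rs H"
proof -
  let ?S = "the_inv_into {1<..<R} H"
  have S: "?S s = exp (L s)" if "s \<in> {1<..<Rs}" for s
    using the_inv_into_f_f[OF bij_betw_imp_inj_on[OF H_bij], of "exp (L s)"] H_exp_L[OF that] by simp
  obtain q' where cq': "continuous_on {1..Rs} q'"
    and q': "\<And>y. y \<in> {1..Rs} \<Longrightarrow> (q c has_real_derivative q' y) (at y within {1..Rs})"
    using q_has_derivative[OF c] by blast
  have gp: "0 < g c s" if "s \<in> {1<..<Rs}" for s using g_pos[OF noncritical[OF that]] that by simp
  have qp: "0 < q c s" if "s \<in> {1<..<Rs}" for s using q_pos[OF noncritical[OF that]] that by simp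
  define g' where "g' = (\<lambda>s. sqrt (q c s) + s * (q' s / (2 * sqrt (q c s))))"
  define S1 where "S1 = (\<lambda>s. exp (L s) / g c s)"
  define S2 where "S2 = (\<lambda>s. (S1 s * g c s - exp (L s) * g' s) / (g c s * g c s))"
  have dg: "(g c has_real_derivative g' s) (at s)" if s: "s \<in> {1<..<Rs}" for s
  proof -
    have "(q c has_real_derivative q' s) (at s)" using q'[of s] s at_within_interval[OF s] by simp
    from DERIV_chain2[OF DERIV_real_sqrt[OF qp[OF s]] this]
    have "((\<lambda>s. sqrt (q c s)) has_real_derivative q' s / (2 * sqrt (q c s))) (at s)"
      by (rule DERIV_cong) (simp add: inverse_eq_divide)
    from DERIV_mult[OF DERIV_ident this] show ?thesis
      unfolding g_def[abs_def] g'_def by (rule DERIV_cong) simp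
  qed
  have dL: "(L has_real_derivative inverse (g c s)) (at s)" if s: "s \<in> {1<..<Rs}" for s
  proof -
    have "g c s \<noteq> 0" using gp[OF s] by simp
    from DERIV_isCont[OF DERIV_inverse_fun[OF dg[OF s] this]]
    have "continuous (at s within {1..Rs}) (\<lambda>y. inverse (g c y))"
      by (rule continuous_at_imp_continuous_at_within)
    \<comment> \<open>The reciprocal is only integrable on the closed interval, so the fundamental
      theorem is used at a single point of continuity.\<close>
    from integral_has_vector_derivative_continuous_at[OF integrable_f, of s "{}"] this s
    have "((\<lambda>u. integral {1..u} (\<lambda>y. inverse (g c y))) has_vector_derivative inverse (g c s)) (at s within {1..Rs})"
      by simp
    then show ?thesis
      using at_within_interval[OF s] by (simp add: L_def[abs_def] has_real_derivative_iff_has_vector_derivative)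
  qed
  have dE: "((\<lambda>s. exp (L s)) has_real_derivative S1 s) (at s)" if "s \<in> {1<..<Rs}" for s
    using DERIV_fun_exp[OF dL[OF that]] by (simp add: S1_def divide_inverse)
  have "(?S has_real_derivative S1 s) (at s)" if "s \<in> {1<..<Rs}" for s
    by (rule has_field_derivative_transform_within_open[OF dE[OF that] open_greaterThanLessThan that]) (simp add: S)
  moreover have "(S1 has_real_derivative S2 s) (at s)" if s: "s \<in> {1<..<Rs}" for s
    using DERIV_divide[OF dE[OF s] dg[OF s]] gp[OF s] unfolding S1_def[abs_def] S2_def by (simp add: S1_def)
  moreover have "continuous_on {1<..<Rs} S2"
  proof -
    have sub: "{1<..<Rs} \<subseteq> {1..Rs}" by auto
    note cont = continuous_on_subset[OF continuous_g sub] continuous_on_subset[OF continuous_q[OF c] sub]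
      continuous_on_subset[OF cq' sub] continuous_on_subset[OF continuous_L sub]
    have nz: "q c s \<noteq> 0" "g c s \<noteq> 0" if "s \<in> {1<..<Rs}" for s using qp[OF that] gp[OF that] by simp_all
    have "continuous_on {1<..<Rs} g'"
      unfolding g'_def by (intro continuous_intros cont) (simp_all add: nz)
    then show ?thesis
      unfolding S2_def S1_def by (intro continuous_intros cont) (simp_all add: nz)
  qed
  ultimately have "C2_on {1<..<Rs} ?S" unfolding C2_on_def by blast
  then show ?thesis using homeo by (simp add: increasing_C2_diffeo_def)
qed

end

section \<open>Radial harmonic maps\<close>

context metric_on_annulus
begin

lemma \<rho>_differentiable:
  assumes "y \<in> {1<..<Rs}" shows "\<rho> differentiable (at y)"
proof -
  obtain \<rho>' where "\<And>y. y \<in> {1..Rs} \<Longrightarrow> (\<rho> has_real_derivative \<rho>' y) (at y within {1..Rs})"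
    using regular unfolding regular_metric_def by blast
  from this[of y] show ?thesis
    using assms at_within_interval[OF assms] by (auto simp: real_differentiable_def)
qed

text \<open>Differentiability of the inverse \<open>S\<close> excludes \<open>H' = 0\<close>, so
  \<open>Phi\<close> is below 1 along the solution and \<open>c < m\<close> in the interior; letting
  the argument tend to 1 gives \<open>c \<le> \<rho> 1\<close>. Moreover \<open>ln S\<close> is an
  antiderivative of \<open>1 / g c\<close>, which identifies \<open>S\<close> with
  \<open>T\<close>.\<close>

lemma diffeo_unique:
  assumes H: "increasing_C2_diffeo R Rs H"
    and H': "\<And>t. t \<in> {1<..<R} \<Longrightarrow> (H has_real_derivative H' t) (at t)"
    and first_integral: "\<And>t. t \<in> {1<..<R} \<Longrightarrow> \<rho> (H t) * H t ^ n * Phi n ((t * H' t / H t)\<^sup>2) = c"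
    and R: "R > 1"
  shows "c \<le> \<rho> 1" and "\<And>t. t \<in> {1<..<R} \<Longrightarrow> H_inv n \<rho> Rs c t = H t"
proof -
  define S where "S = the_inv_into {1<..<R} H"
  have mono: "strict_mono_on {1<..<R} H" and bij: "bij_betw H {1<..<R} {1<..<Rs}" and C2: "C2_on {1<..<Rs} S"
    using H by (auto simp: increasing_C2_diffeo_def increasing_C2_homeo_def S_def)
  have Hin: "H t \<in> {1<..<Rs}" if "t \<in> {1<..<R}" for t using bij that by (meson bij_betwE)
  have SH: "S (H t) = t" if "t \<in> {1<..<R}" for t
    unfolding S_def by (rule the_inv_into_f_f[OF bij_betw_imp_inj_on[OF bij] that])
  have HS: "H (S s) = s" and Sin: "S s \<in> {1<..<R}" if "s \<in> {1<..<Rs}" for s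
    using f_the_inv_into_f_bij_betw[OF bij, of s] bij_betwE[OF bij_betw_the_inv_into[OF bij]] that
    by (auto simp: S_def)
  obtain S' where S': "\<And>s. s \<in> {1<..<Rs} \<Longrightarrow> (S has_real_derivative S' s) (at s)"
    using C2 unfolding C2_on_def by blast
  have SH': "S' (H t) * H' t = 1" if t: "t \<in> {1<..<R}" for t
  proof (rule DERIV_unique)
    show "((\<lambda>t. S (H t)) has_real_derivative S' (H t) * H' t) (at t)"
      by (rule DERIV_chain2[OF S'[OF Hin[OF t]] H'[OF t]])
    show "((\<lambda>t. S (H t)) has_real_derivative 1) (at t)"
      by (rule has_field_derivative_transform_within_open[OF DERIV_ident open_greaterThanLessThan t]) (simp add: SH)
  qed
  have H'_pos: "0 < H' t" if t: "t \<in> {1<..<R}" for t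
  proof -
    have "0 \<le> H' t"
      using mono_on_imp_deriv_nonneg[OF strict_mono_on_imp_mono_on[OF mono] H'[OF t]] t
      by (simp add: interior_open)
    moreover have "H' t \<noteq> 0" using SH'[OF t] by auto
    ultimately show ?thesis by simp
  qed
  define \<zeta> where "\<zeta> = (\<lambda>t. (t * H' t / H t)\<^sup>2)"
  have \<zeta>: "0 < \<zeta> t" if "t \<in> {1<..<R}" for t
    using H'_pos[OF that] Hin[OF that] that by (simp add: \<zeta>_def)
  have c: "c = m (H t) * Phi n (\<zeta> t)" if "t \<in> {1<..<R}" for t
    using first_integral[OF that] by (simp add: m_def \<zeta>_def mult_ac)
  have c_less: "c < m s" if s: "s \<in> {1<..<Rs}" for s
  proof -
    have "Phi n (\<zeta> (S s)) < 1"
      using Phi_strict_antimono[OF n _ \<zeta>[OF Sin[OF s]]] by simp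
    then show ?thesis
      using c[OF Sin[OF s]] m_pos[of s] s HS[OF s] by simp
  qed
  have "c \<le> m 1"
    by (rule continuous_ge_on_closure[where S = "{1<..<Rs}"])
      (use Rs continuous_m c_less less_imp_le in \<open>auto simp: closure_greaterThanLessThan\<close>)
  then show c1: "c \<le> \<rho> 1" by simp
  have g: "inverse (g c s) = S' s / S s" if s: "s \<in> {1<..<Rs}" for s
  proof -
    let ?t = "S s"
    note t = Sin[OF s]
    have "0 < m s" using m_pos[of s] s by simp
    then have "c / m s = Phi n (\<zeta> ?t)" using c[OF t] HS[OF s] by simp
    then have "q c s = (?t * H' ?t / s)\<^sup>2"
      using Psi_Phi[OF n, of "\<zeta> ?t"] \<zeta>[OF t] HS[OF s] by (simp add: q_def v_eq \<zeta>_def)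
    then have "g c s = ?t * H' ?t"
      using s t H'_pos[OF t] by (simp add: g_def)
    moreover have "S' s * H' ?t = 1" using SH'[OF t] HS[OF s] by simp
    ultimately show ?thesis using t H'_pos[OF t] by (simp add: field_simps)
  qed
  \<comment> \<open>\<open>H\<close> and \<open>S\<close> live on open intervals, so
    \<open>ln S\<close> is extended by its limit 0 at the left end point.\<close>
  define F where "F = (\<lambda>s. if s \<le> 1 then 0 else ln (S s))"
  have F': "(F has_real_derivative inverse (g c s)) (at s)" if s: "s \<in> {1<..<Rs}" for s
  proof -
    have "0 < S s" using Sin[OF s] by simp
    from DERIV_chain2[OF DERIV_ln[OF this] S'[OF s]]
    have "((\<lambda>s. ln (S s)) has_real_derivative inverse (g c s)) (at s)"
      using g[OF s] by (simp add: divide_inverse mult.commute)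
    then show ?thesis
      by (rule has_field_derivative_transform_within_open[OF _ open_greaterThanLessThan s]) (simp add: F_def)
  qed
  have F1: "continuous (at 1 within {1..s}) F" for s
    unfolding continuous_within_eps_delta
  proof (intro allI impI)
    fix e :: real assume "e > 0"
    \<comment> \<open>A point of \<open>(1, R)\<close> below \<open>exp e\<close>: for
      \<open>y\<close> in \<open>(1, H t)\<close> one gets \<open>S y < t\<close> and hence
      \<open>ln (S y) < e\<close>.\<close>
    define t where "t = (1 + min (exp e) R) / 2"
    have t: "t \<in> {1<..<R}" "t < exp e" using \<open>e > 0\<close> R by (auto simp: t_def min_def)
    have "dist (F y) (F 1) < e" if "y \<in> {1..s}" "dist y 1 < H t - 1" for y
    proof (cases "y = 1")
      case False
      then have y: "y \<in> {1<..<Rs}" "y < H t" using that Hin[OF t(1)] by (auto simp: dist_real_def)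
      have "S y < t"
        using strict_mono_on_less[OF mono Sin[OF y(1)] t(1)] HS[OF y(1)] y(2) by simp
      then have "ln (S y) < ln (exp e)" using Sin[OF y(1)] t by (subst ln_less_cancel_iff) auto
      then have "ln (S y) < e" by simp
      moreover have "0 < ln (S y)" using Sin[OF y(1)] by simp
      ultimately show ?thesis using y by (simp add: F_def dist_real_def)
    qed (use \<open>e > 0\<close> in simp)
    then show "\<exists>d>0. \<forall>y\<in>{1..s}. dist y 1 < d \<longrightarrow> dist (F y) (F 1) < e"
      using Hin[OF t(1)] by (intro exI[of _ "H t - 1"]) auto
  qed
  have T: "T n \<rho> c s = ereal (S s)" if s: "s \<in> {1<..<Rs}" for s
  proof -
    have "continuous_on {1..s} F"
      unfolding continuous_on_eq_continuous_within
    proof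
      fix y assume "y \<in> {1..s}"
      then consider "y = 1" | "y \<in> {1<..<Rs}" using s by force
      then show "continuous (at y within {1..s}) F"
        using F1 DERIV_isCont[OF F'] by cases (auto intro: continuous_at_imp_continuous_at_within)
    qed
    then have "((\<lambda>y. inverse (g c y)) has_integral F s - F 1) {1..s}"
      by (rule fundamental_theorem_of_calculus_interior[rotated])
        (use s F' in \<open>auto simp: has_real_derivative_iff_has_vector_derivative\<close>)
    moreover have "AE y in lborel. y \<in> {1..s} \<longrightarrow> g c y \<noteq> 0"
    \<comment> \<open>At 1 the function \<open>g c\<close> may vanish; a single point is a null
      set.\<close>
    proof (rule eventually_mono[OF AE_lborel_singleton[of 1]], rule impI)
      fix y assume "y \<noteq> 1" "y \<in> {1..s}"
      then show "g c y \<noteq> 0" using g_pos[of c y] c_less[of y] s by force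
    qed
    ultimately have "T n \<rho> c s = ereal (exp (F s - F 1))"
      by (rule T_eq_exp_integral[OF c1 less_imp_le, rotated]) (use s in simp)
    then show ?thesis using s Sin[OF s] by (simp add: F_def)
  qed
  show "H_inv n \<rho> Rs c t = H t" if t: "t \<in> {1<..<R}" for t
    unfolding H_inv_def the_inv_into_def
  proof (rule the_equality)
    show "H t \<in> {1..Rs} \<and> T n \<rho> c (H t) = ereal t"
      using T[OF Hin[OF t]] SH[OF t] Hin[OF t] by auto
    \<comment> \<open>\<open>H_inv\<close> inverts over the closed interval, so both end points must
      be ruled out as further preimages. Monotonicity of \<open>T\<close> does this by comparison
      with an intermediate radius \<open>t'\<close>.\<close>
    fix y assume y: "y \<in> {1..Rs} \<and> T n \<rho> c y = ereal t"
    have "y \<noteq> 1"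
    proof
      define t' where "t' = (1 + t) / 2"
      have t': "t' \<in> {1<..<R}" "t' < t" using t by (auto simp: t'_def)
      assume "y = 1"
      then have "ereal t \<le> ereal t'"
        using y T_mono_s[of 1 "H t'" c] T[OF Hin[OF t'(1)]] SH[OF t'(1)] Hin[OF t'(1)] by simp
      then show False using t' by simp
    qed
    moreover have "y \<noteq> Rs"
    proof
      define t' where "t' = (t + R) / 2"
      have t': "t' \<in> {1<..<R}" "t < t'" using t by (auto simp: t'_def)
      assume "y = Rs"
      then have "ereal t' \<le> ereal t"
        using y T_mono_s[of "H t'" Rs c] T[OF Hin[OF t'(1)]] SH[OF t'(1)] Hin[OF t'(1)] by simp
      then show False using t' by simp
    qed
    ultimately have "y \<in> {1<..<Rs}" using y by auto
    then show "y = H t" using T[of y] y HS[of y] by simp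
  qed
qed

lemma radius_bound:
  assumes c: "c \<le> \<rho> 1" and R: "1 < R" and inj: "inj_on (H_inv n \<rho> Rs c) {1<..<R}"
  shows "ereal R \<le> T n \<rho> (\<rho> 1) Rs"
proof (rule ccontr)
  assume "\<not> ?thesis"
  then obtain z where z: "T n \<rho> (\<rho> 1) Rs < ereal z" "z < R"
    using ereal_dense2[of "T n \<rho> (\<rho> 1) Rs" "ereal R"] by (auto simp: not_le)
  have junk: "(y \<in> {1..Rs} \<and> T n \<rho> c y = ereal t) = False" if "z < t" for y t
  proof
    assume y: "y \<in> {1..Rs} \<and> T n \<rho> c y = ereal t"
    then have "ereal t \<le> T n \<rho> c Rs" using T_mono_s[of y Rs c] by simp
    also have "\<dots> \<le> T n \<rho> (\<rho> 1) Rs" by (rule T_mono_c[OF c order_refl order_refl])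
    also have "\<dots> < ereal z" by (rule z(1))
    finally show False using that by simp
  qed simp
  define t1 where "t1 = (max 1 z + R) / 2"
  define t2 where "t2 = (t1 + R) / 2"
  have t: "t1 \<in> {1<..<R}" "t2 \<in> {1<..<R}" "z < t1" "z < t2" "t1 \<noteq> t2"
    using R z(2) by (auto simp: t1_def t2_def max_def field_simps)
  have "H_inv n \<rho> Rs c t1 = H_inv n \<rho> Rs c t2"
    \<comment> \<open>Neither radius is a value of \<open>T\<close> for the parameter
      \<open>c\<close>, so both definite descriptions have the predicate \<open>False\<close> and
      denote the same unspecified value. This contradicts injectivity.\<close>
    by (simp only: H_inv_def the_inv_into_def junk[OF t(3)] junk[OF t(4)])
  then show False using inj_onD[OF inj _ t(1,2)] t(5) by blast
qed

end

section \<open>From radial profiles to maps\<close>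

lemma radial_map_eq_iff:
  fixes H K :: "real \<Rightarrow> real"
  shows "(\<forall>x\<in>annulus 1 R. radial_map H x = (radial_map K x :: real^'n)) \<longleftrightarrow> (\<forall>t\<in>{1<..<R}. H t = K t)"
proof
  assume eq: "\<forall>x\<in>annulus 1 R. radial_map H x = (radial_map K x :: real^'n)"
  show "\<forall>t\<in>{1<..<R}. H t = K t"
  proof
    fix t :: real assume t: "t \<in> {1<..<R}"
    define x :: "real^'n" where "x = t *\<^sub>R axis undefined 1"
    have nx: "norm x = t" using t by (simp add: x_def)
    then have "radial_map H x = radial_map K x" using eq t by (simp add: annulus_def)
    moreover have "x \<noteq> 0" using nx t by auto
    ultimately show "H t = K t" using t by (simp add: radial_map_def nx)
  qed
qed (simp add: radial_map_def annulus_def)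

lemma radial_harmonic_diffeo_imp_homeo:
  "radial_harmonic_diffeo \<rho> R Rs h \<Longrightarrow> radial_harmonic_homeo \<rho> R Rs h"
  by (auto simp: radial_harmonic_diffeo_def radial_harmonic_homeo_def increasing_C2_diffeo_def)

lemma radial_harmonic_homeo_radius_bound:
  fixes h :: "real^'n \<Rightarrow> real^'n"
  assumes "metric_on_annulus CARD('n) \<rho> Rs" and "1 < R"
    and h: "radial_harmonic_homeo \<rho> R Rs h" and c: "c \<le> \<rho> 1" "\<forall>x\<in>annulus 1 R. h x = h_map \<rho> Rs c x"
  shows "ereal R \<le> T CARD('n) \<rho> (\<rho> 1) Rs"
proof -
  interpret metric_on_annulus "CARD('n)" \<rho> Rs by fact
  obtain H where H: "increasing_C2_homeo R Rs H" "\<forall>x\<in>annulus 1 R. h x = radial_map H x"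
    using h by (auto simp: radial_harmonic_homeo_def)
  then have "\<forall>x::real^'n\<in>annulus 1 R. radial_map (H_inv CARD('n) \<rho> Rs c) x = radial_map H x"
    using c(2) by (simp add: h_map_def)
  then have eq: "\<forall>t\<in>{1<..<R}. H_inv CARD('n) \<rho> Rs c t = H t"
    unfolding radial_map_eq_iff .
  moreover have "inj_on H {1<..<R}"
    using H(1) by (auto simp: increasing_C2_homeo_def bij_betw_def)
  ultimately have "inj_on (H_inv CARD('n) \<rho> Rs c) {1<..<R}" by (metis inj_on_cong)
  then show ?thesis by (rule radius_bound[OF c(1) \<open>1 < R\<close>])
qed

text \<open>The inner variation equation yields the constant \<open>c\<close> of the first integral;
  \<open>diffeo_unique\<close> then bounds \<open>c\<close> and recovers the profile as
  \<open>H_inv\<close>.\<close>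

lemma radial_harmonic_diffeo_eq_h_map:
  fixes h :: "real^'n \<Rightarrow> real^'n"
  assumes "metric_on_annulus CARD('n) \<rho> Rs" and R: "1 < R"
    and h: "radial_harmonic_diffeo \<rho> R Rs h"
  shows "\<exists>c\<le>\<rho> 1. \<forall>x\<in>annulus 1 R. h x = h_map \<rho> Rs c x"
proof -
  interpret metric_on_annulus "CARD('n)" \<rho> Rs by fact
  obtain H where H: "increasing_C2_diffeo R Rs H" and hH: "\<And>x. x \<in> annulus 1 R \<Longrightarrow> h x = radial_map H x"
    and eq: "inner_variation_eq \<rho> R h"
    using h by (auto simp: radial_harmonic_diffeo_def)
  obtain H' H'' where H': "\<And>t. t \<in> {1<..<R} \<Longrightarrow> (H has_real_derivative H' t) (at t)"
    and H'': "\<And>t. t \<in> {1<..<R} \<Longrightarrow> (H' has_real_derivative H'' t) (at t)"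
    using H unfolding increasing_C2_diffeo_def increasing_C2_homeo_def C2_on_def by blast
  have Hin: "H t \<in> {1<..<Rs}" if "t \<in> {1<..<R}" for t
    using H that bij_betwE unfolding increasing_C2_diffeo_def increasing_C2_homeo_def by blast
  obtain c where c: "\<And>t. t \<in> {1<..<R} \<Longrightarrow> \<rho> (H t) * H t ^ CARD('n) * Phi CARD('n) ((t * H' t / H t)\<^sup>2) = c"
  proof (rule inner_variation_eqD[OF n hH H' _ _ _ eq])
    show "H' differentiable (at t)" if "t \<in> {1<..<R}" for t
      using H''[OF that] by (auto simp: real_differentiable_def)
    show "0 < H t" if "t \<in> {1<..<R}" for t using Hin[OF that] by simp
    show "\<rho> differentiable (at (H t))" if "t \<in> {1<..<R}" for t
      by (rule \<rho>_differentiable[OF Hin[OF that]])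
  qed blast+
  have "\<forall>x::real^'n\<in>annulus 1 R. radial_map H x = radial_map (H_inv CARD('n) \<rho> Rs c) x"
    unfolding radial_map_eq_iff using diffeo_unique(2)[OF H H' c R] by simp
  then show ?thesis using diffeo_unique(1)[OF H H' c R] hH by (auto simp: h_map_def)
qed

lemma h_map_inner_variation:
  assumes "critical_radius CARD('n::finite) \<rho> Rs R c"
  shows "inner_variation_eq \<rho> R (h_map \<rho> Rs c :: real^'n \<Rightarrow> real^'n)"
proof -
  interpret critical_radius "CARD('n)" \<rho> Rs R c by fact
  show ?thesis
    by (rule inner_variation_eqI[OF n _ H_has_derivative _ first_integral])
      (use H_interior in \<open>force simp: h_map_def\<close>)+
qed

text \<open>When \<open>R\<close> equals the critical value, \<open>H'\<close> may vanish at an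
  interior minimum of \<open>\<rho> s * s^n\<close>, which destroys differentiability of the
  inverse. Hence the equivalence for diffeomorphisms carries a condition at that single radius,
  while the one for homeomorphisms does not.\<close>

theorem theorem2p2:
  fixes \<rho> :: "real \<Rightarrow> real" and R Rs :: real
  assumes "CARD('n::finite) \<ge> 3" and "R > 1" and "Rs > 1"
    and "regular_metric CARD('n) Rs \<rho>"
  shows
    "((ereal R = T CARD('n) \<rho> (\<rho> 1) Rs \<longrightarrow> (\<forall>s\<in>{1<..<Rs}. \<rho> 1 < \<rho> s * s ^ CARD('n))) \<longrightarrow>
       ((\<exists>h :: real^'n \<Rightarrow> real^'n. radial_harmonic_diffeo \<rho> R Rs h \<and>
           (\<exists>c\<le>\<rho> 1. \<forall>x\<in>annulus 1 R. h x = h_map \<rho> Rs c x))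
        \<longleftrightarrow> ereal R \<le> T CARD('n) \<rho> (\<rho> 1) Rs))
     \<and> ((\<exists>h :: real^'n \<Rightarrow> real^'n. radial_harmonic_homeo \<rho> R Rs h \<and>
           (\<exists>c\<le>\<rho> 1. \<forall>x\<in>annulus 1 R. h x = h_map \<rho> Rs c x))
        \<longleftrightarrow> ereal R \<le> T CARD('n) \<rho> (\<rho> 1) Rs)
     \<and> (ereal R \<le> T CARD('n) \<rho> (\<rho> 1) Rs \<longleftrightarrow> (\<exists>c\<le>\<rho> 1. T CARD('n) \<rho> c Rs = ereal R))
     \<and> (\<forall>h :: real^'n \<Rightarrow> real^'n. radial_harmonic_diffeo \<rho> R Rs h \<longrightarrow>
          (\<exists>c\<le>\<rho> 1. \<forall>x\<in>annulus 1 R. h x = h_map \<rho> Rs c x))"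
    (is "(?noncritical \<longrightarrow> (?diffeo \<longleftrightarrow> ?le)) \<and> (?homeo \<longleftrightarrow> ?le) \<and> (?le \<longleftrightarrow> ?ex) \<and> ?unique")
proof -
  interpret metric_on_annulus "CARD('n)" \<rho> Rs
    using assms by unfold_locales
  have homeoD: ?le if ?homeo
    using that radial_harmonic_homeo_radius_bound[OF metric_on_annulus_axioms \<open>R > 1\<close>] by blast
  have diffeoD: ?le if ?diffeo
    using that homeoD radial_harmonic_diffeo_imp_homeo by blast
  have ex: ?ex if ?le
    using exists_parameter[OF \<open>R > 1\<close> that] by blast
  have exD: ?le if ?ex
    using that T_mono_c[OF _ order_refl order_refl] by metis
  have homeoI: ?homeo if le: ?le
  proof -
    obtain c where c: "c \<le> \<rho> 1" "T CARD('n) \<rho> c Rs = ereal R" using ex[OF le] by blast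
    interpret critical_radius "CARD('n)" \<rho> Rs R c
      using c \<open>R > 1\<close> by unfold_locales
    have "radial_harmonic_homeo \<rho> R Rs (h_map \<rho> Rs c :: real^'n \<Rightarrow> real^'n)"
      unfolding radial_harmonic_homeo_def
      using homeo h_map_inner_variation[OF critical_radius_axioms] by (auto simp: h_map_def)
    then show ?thesis using c by blast
  qed
  have diffeoI: ?diffeo if le: ?le and nc: ?noncritical
  proof -
    obtain c where c: "c \<le> \<rho> 1" "T CARD('n) \<rho> c Rs = ereal R" using ex[OF le] by blast
    interpret critical_radius "CARD('n)" \<rho> Rs R c
      using c \<open>R > 1\<close> by unfold_locales
    have "c < m s" if s: "s \<in> {1<..<Rs}" for s
    \<comment> \<open>For the critical parameter, \<open>R\<close> equals the critical value, which
      activates the noncriticality condition; below it, \<open>m_ge\<close> gives strictness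
      directly.\<close>
    proof (cases "c = \<rho> 1")
      case True
      then have "\<forall>s\<in>{1<..<Rs}. \<rho> 1 < \<rho> s * s ^ CARD('n)" using nc T_Rs by simp
      then show ?thesis using s True by (simp add: m_def mult.commute)
    next
      case False
      then show ?thesis using c m_ge[of s] s by simp
    qed
    then have "radial_harmonic_diffeo \<rho> R Rs (h_map \<rho> Rs c :: real^'n \<Rightarrow> real^'n)"
      unfolding radial_harmonic_diffeo_def
      using diffeo h_map_inner_variation[OF critical_radius_axioms] by (auto simp: h_map_def)
    then show ?thesis using c by blast
  qed
  have unique: ?unique
    using radial_harmonic_diffeo_eq_h_map[OF metric_on_annulus_axioms \<open>R > 1\<close>] by blast
  show ?thesis using homeoD homeoI diffeoD diffeoI ex exD unique by blast
qed

end
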